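(* Let $q=2^h$ with $h>1$ and let $n$ be a prime. Let $\mathcal{H}$ be a pseudo-hyperoval in $\mathrm{PG}(3n-1,q)$ such that the spread induced by at least $q^n+1$ elements of $\mathcal{H}$ is Desarguesian (i.e. there are at least $q^n+1$ elements of $\mathcal{H}$ each of which induces a Desarguesian spread). Then $\mathcal{H}$ is elementary.
   Context: Dimensions are projective: an $(n-1)$-space of $\mathrm{PG}(m,q)$ comes from an $n$-dimensional $\mathbb{F}_q$-vector subspace. A pseudo-arc in $\mathrm{PG}(3n-1,q)$ is a set of $(n-1)$-spaces any three distinct elements $E_i,E_j,E_k$ of which satisfy $\langle E_i,E_j\rangle\cap E_k=\emptyset$ (equivalently, any three span the whole space). A pseudo-hyperoval is a pseudo-arc of size $q^n+2$. An $(n-1)$-spread of $\mathrm{PG}(2n-1,q)$ is a set of $(n-1)$-spaces partitioning the point set. An element $E_i$ of a pseudo-hyperoval $\mathcal{H}$ induces the spread $\{\langle E_i,E_j\rangle/E_i : E_j\in\mathcal{H},\ j\ne i\}$ (which has $q^n+1$ elements) of the quotient space $\mathrm{PG}(3n-1,q)/E_i\cong\mathrm{PG}(2n-1,q)$. Field reduction: given an $\mathbb{F}_q$-linear isomorphism $\mathbb{F}_{q^n}^r\cong\mathbb{F}_q^{rn}$, a point of $\mathrm{PG}(r-1,q^n)$, being a 1-dimensional $\mathbb{F}_{q^n}$-subspace, corresponds to an $n$-dimensional $\mathbb{F}_q$-subspace, i.e. an $(n-1)$-space of $\mathrm{PG}(rn-1,q)$. A Desarguesian $(n-1)$-spread of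 $\mathrm{PG}(rn-1,q)$ is the set of $(n-1)$-spaces arising in this way (for some such isomorphism) from all points of $\mathrm{PG}(r-1,q^n)$. A pseudo-arc in $\mathrm{PG}(3n-1,q)$ is elementary if it is obtained by field reduction from an arc (a set of points, no three collinear) of $\mathrm{PG}(2,q^n)$. *)

theory Defs
  imports "HOL-Analysis.Cartesian_Space" "HOL-Library.Numeral_Type" "HOL-Library.Set_Algebras"
    "HOL-Computational_Algebra.Primes"
begin

text \<open>
  Projective spaces are represented by vector spaces: \<open>PG(m,q)\<close> is an \<open>(m+1)\<close>-dimensional vector
  space over a field with \<open>q\<close> elements, and its \<open>(k-1)\<close>-spaces are the \<open>k\<close>-dimensional linear
  subspaces. In particular projective subspaces are disjoint iff they meet in \<open>{0}\<close>.

  The extension \<open>F\<^bsub>q^n\<^esub>\<close> of \<open>F\<^bsub>q\<^esub>\<close> is a second field type together with an embedding \<open>\<iota>\<close>.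
\<close>

definition field_embedding :: "('a::field \<Rightarrow> 'k::field) \<Rightarrow> bool" where
  "field_embedding \<iota> \<longleftrightarrow>
     \<iota> 1 = 1 \<and> (\<forall>x y. \<iota> (x + y) = \<iota> x + \<iota> y) \<and> (\<forall>x y. \<iota> (x * y) = \<iota> x * \<iota> y)"

definition pg_points :: "('k::field ^ 'r::finite) set set" where
  "pg_points = {P. vec.subspace P \<and> vec.dim P = 1}"

definition pg_lines :: "('k::field ^ 'r::finite) set set" where
  "pg_lines = {L. vec.subspace L \<and> vec.dim L = 2}"

definition pg_arc :: "('k::field ^ 3) set set \<Rightarrow> bool" where
  "pg_arc A \<longleftrightarrow> A \<subseteq> pg_points \<and>
     (\<forall>P\<in>A. \<forall>Q\<in>A. \<forall>R\<in>A. P \<noteq> Q \<longrightarrow> P \<noteq> R \<longrightarrow> Q \<noteq> R \<longrightarrow>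
        \<not> (\<exists>L\<in>pg_lines. P \<subseteq> L \<and> Q \<subseteq> L \<and> R \<subseteq> L))"

text \<open>
  Isomorphisms of vector spaces over the small field from \<open>K\<^sup>r\<close>, with scalars restricted along \<open>\<iota>\<close>,
  onto the vector space with carrier \<open>W\<close>, addition \<open>add\<close> and scalar multiplication \<open>smul\<close>.
  The target has an explicit carrier because it may be a quotient space, whose vectors are cosets.
\<close>

definition field_reduction_iso ::
  "('a::field \<Rightarrow> 'k::field) \<Rightarrow> 'w set \<Rightarrow> ('w \<Rightarrow> 'w \<Rightarrow> 'w) \<Rightarrow> ('a \<Rightarrow> 'w \<Rightarrow> 'w)
    \<Rightarrow> ('k ^ 'r::finite \<Rightarrow> 'w) \<Rightarrow> bool" where
  "field_reduction_iso \<iota> W add smul \<phi> \<longleftrightarrow>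
     bij_betw \<phi> UNIV W \<and>
     (\<forall>x y. \<phi> (x + y) = add (\<phi> x) (\<phi> y)) \<and>
     (\<forall>c x. \<phi> (\<iota> c *s x) = smul c (\<phi> x))"

definition field_reduction :: "('k ^ 'r \<Rightarrow> 'w) \<Rightarrow> ('k ^ 'r) set set \<Rightarrow> 'w set set" where
  "field_reduction \<phi> A = (\<lambda>P. \<phi> ` P) ` A"

text \<open>The type argument determines the rank \<open>r\<close>: the spread lives in \<open>PG(rn-1,q)\<close>.\<close>

definition desarguesian_spread ::
  "'r::finite itself \<Rightarrow> ('a::field \<Rightarrow> 'k::field) \<Rightarrow> 'w set \<Rightarrow> ('w \<Rightarrow> 'w \<Rightarrow> 'w)
    \<Rightarrow> ('a \<Rightarrow> 'w \<Rightarrow> 'w) \<Rightarrow> 'w set set \<Rightarrow> bool" where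
  "desarguesian_spread _ \<iota> W add smul S \<longleftrightarrow>
     (\<exists>\<phi> :: 'k ^ 'r \<Rightarrow> 'w. field_reduction_iso \<iota> W add smul \<phi> \<and> S = field_reduction \<phi> pg_points)"

definition cosets :: "'v::ab_group_add set \<Rightarrow> 'v set \<Rightarrow> 'v set set" where
  "cosets E U = (\<lambda>v. v +o E) ` U"

definition pseudo_arc :: "('a::field \<Rightarrow> 'v::ab_group_add \<Rightarrow> 'v) \<Rightarrow> nat \<Rightarrow> 'v set set \<Rightarrow> bool" where
  "pseudo_arc smul n H \<longleftrightarrow>
     (\<forall>E\<in>H. module.subspace smul E \<and> vector_space.dim smul E = n) \<and>
     (\<forall>E\<in>H. \<forall>F\<in>H. \<forall>G\<in>H. E \<noteq> F \<longrightarrow> E \<noteq> G \<longrightarrow> F \<noteq> G \<longrightarrow>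
        module.span smul (E \<union> F) \<inter> G = {0})"

definition pseudo_hyperoval ::
  "('a::field \<Rightarrow> 'v::ab_group_add \<Rightarrow> 'v) \<Rightarrow> nat \<Rightarrow> 'v set set \<Rightarrow> bool" where
  "pseudo_hyperoval smul n H \<longleftrightarrow> pseudo_arc smul n H \<and> card H = CARD('a) ^ n + 2"

text \<open>
  The vectors of the quotient space by \<open>E\<close> are the cosets of \<open>E\<close>. They are added elementwise; adding
  \<open>E\<close> in the scalar multiplication matters only for the scalar \<open>0\<close>, where the elementwise
  multiple of a coset is \<open>{0}\<close> instead of \<open>E\<close>.
\<close>

definition quotient_scale ::
  "('a::field \<Rightarrow> 'v::ab_group_add \<Rightarrow> 'v) \<Rightarrow> 'v set \<Rightarrow> 'a \<Rightarrow> 'v set \<Rightarrow> 'v set" where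
  "quotient_scale smul E c X = smul c ` X + E"

lemma coset_plus_coset:
  assumes "vector_space smul" and "module.subspace smul E"
  shows "(v +o E) + (w +o E) = (v + w) +o E"
proof -
  interpret vector_space smul by fact
  have "E + E = E"
  proof
    show "E + E \<subseteq> E"
      using subspace_add[OF assms(2)] by (auto simp: set_plus_def)
    show "E \<subseteq> E + E"
      using subspace_0[OF assms(2)] by (force simp: set_plus_def)
  qed
  then show ?thesis
    by (simp add: set_plus_rearrange)
qed

lemma quotient_scale_coset:
  assumes "vector_space smul" and "module.subspace smul E"
  shows "quotient_scale smul E c (v +o E) = smul c v +o E"
proof
  interpret vector_space smul by fact
  note E = subspace_add[OF assms(2)] subspace_scale[OF assms(2)] subspace_0[OF assms(2)]
  show "quotient_scale smul E c (v +o E) \<subseteq> smul c v +o E"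
    using E by (force simp: quotient_scale_def set_plus_def elt_set_plus_def scale_right_distrib add.assoc)
  show "smul c v +o E \<subseteq> quotient_scale smul E c (v +o E)"
  proof
    fix x assume "x \<in> smul c v +o E"
    then obtain e where "e \<in> E" "x = smul c (v + 0) + e"
      by (auto simp: elt_set_plus_def)
    then show "x \<in> quotient_scale smul E c (v +o E)"
      unfolding quotient_scale_def set_plus_def elt_set_plus_def using E(3) by blast
  qed
qed

definition induced_spread ::
  "('a::field \<Rightarrow> 'v::ab_group_add \<Rightarrow> 'v) \<Rightarrow> 'v set set \<Rightarrow> 'v set \<Rightarrow> 'v set set set" where
  "induced_spread smul H E = {cosets E (module.span smul (E \<union> F)) | F. F \<in> H \<and> F \<noteq> E}"

definition induces_desarguesian ::
  "('a::field \<Rightarrow> 'v::ab_group_add \<Rightarrow> 'v) \<Rightarrow> ('a \<Rightarrow> 'k::field) \<Rightarrow> 'v set set \<Rightarrow> 'v set \<Rightarrow> bool" where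
  "induces_desarguesian smul \<iota> H E \<longleftrightarrow>
     desarguesian_spread TYPE(2) \<iota> (cosets E UNIV) (+) (quotient_scale smul E)
       (induced_spread smul H E)"

definition elementary ::
  "('a::field \<Rightarrow> 'v::ab_group_add \<Rightarrow> 'v) \<Rightarrow> ('a \<Rightarrow> 'k::field) \<Rightarrow> 'v set set \<Rightarrow> bool" where
  "elementary smul \<iota> H \<longleftrightarrow>
     (\<exists>(\<phi> :: 'k ^ 3 \<Rightarrow> 'v) A.
        field_reduction_iso \<iota> UNIV (+) smul \<phi> \<and> pg_arc A \<and> H = field_reduction \<phi> A)"

end

theory Submission
  imports Defs
begin

text \<open>
  Let \<open>A\<close>, \<open>B\<close>, \<open>C\<close> be elements that induce Desarguesian spreads and let \<open>K = F\<^bsub>q^n\<^esub>\<close>. In suitable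
  coordinates \<open>(x, y, z)\<close> with values in \<open>K\<close> these are the coordinate spaces and the other elements are
  \<open>E a = {(x, a x, \<beta> a x)}\<close> for \<open>a \<noteq> 0\<close>, where \<open>\<beta> 1 = id\<close> and the \<open>\<beta> a\<close> together with \<open>0\<close> form a field of
  \<open>F\<^sub>q\<close>-linear maps; \<open>H\<close> is elementary if that field consists of the multiplications of \<open>K\<close>. Comparing
  it with the field of slopes in the quotient by \<open>E a\<close>, and using that a field of degree \<open>n\<close> has no
  proper intermediate field, one finds that otherwise \<open>a \<mapsto> \<beta> a\<close> maps \<open>F\<^sub>q\<close>-lines to \<open>F\<^sub>q\<close>-lines, hence is
  additive as \<open>q > 2\<close>. Exchanging \<open>A\<close> and \<open>B\<close>, the map \<open>\<phi> a = \<beta> (1/a) \<circ> a\<close> is additive as well. In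
  characteristic two both conditions together force \<open>\<beta> = \<phi>\<close>, so every multiplication
  \<open>a = \<beta> (1/a)\<^sup>-\<^sup>1 \<circ> \<beta> a\<close> lies in the field after all.
\<close>

section \<open>Counting in finite fields and vector spaces\<close>

text \<open>If \<open>1 + 1\<close> were nonzero, negation would fix only \<open>0\<close>; the
  pairs \<open>{x, - x}\<close> would partition the nonzero elements, whose number would then be
  even.\<close>

lemma two_eq_0_if_even_card:
  assumes "finite (UNIV :: 'k::ring_1_no_zero_divisors set)" "even CARD('k)"
  shows "(1 :: 'k) + 1 = 0"
proof (rule ccontr)
  assume "(1 :: 'k) + 1 \<noteq> 0"
  then have "(1 + 1) * x \<noteq> 0" if "x \<noteq> 0" for x :: 'k
    using that no_zero_divisors by blast
  then have neg: "x \<noteq> - x" if "x \<noteq> 0" for x :: 'k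
    using that by (simp add: eq_neg_iff_add_eq_0 mult_2)
  have pair: "card {x, - x} = 2" if "x \<noteq> 0" for x :: 'k
    using neg[OF that] by (rule card_2_iff[THEN iffD2, OF exI, OF exI, OF conjI, OF refl])
  define \<C> where "\<C> = (\<lambda>x :: 'k. {x, - x}) ` (UNIV - {0})"
  have un: "\<Union>\<C> = UNIV - {0}"
    by (auto simp: \<C>_def)
  have "2 * card \<C> = card (\<Union>\<C>)"
  proof (rule card_partition)
    show "finite \<C>" "finite (\<Union>\<C>)"
      using finite_subset[OF subset_UNIV assms(1)] by (auto simp: \<C>_def un)
    show "card c = 2" if "c \<in> \<C>" for c
      using that pair unfolding \<C>_def by blast
    show "c \<inter> c' = {}" if "c \<in> \<C>" "c' \<in> \<C>" "c \<noteq> c'" for c c'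
      using that by (auto simp: \<C>_def)
  qed
  then have "even (card (UNIV - {0 :: 'k}))"
    using un by (metis dvd_triv_left)
  then have "even (CARD('k) - 1)"
    using assms(1) by (simp add: card_Diff_singleton)
  then show False
    using assms by (simp add: card_gt_0_iff)
qed

text \<open>Euclidean division in the exponent:
  \<open>q ^ n - 1 = q ^ (n - d) * (q ^ d - 1) + (q ^ (n - d) - 1)\<close>. Repeating it leaves an
  exponent below \<open>d\<close>, where divisibility forces the exponent 0.\<close>

lemma dvd_of_power_minus_one_dvd:
  fixes q d n :: nat
  assumes "q ^ d - 1 dvd q ^ n - 1" "q > 1" "d > 0"
  shows "d dvd n"
  using assms(1)
proof (induction n rule: less_induct)
  case (less n)
  show ?case
  proof (cases "n < d")
    case True
    then have "q ^ n - 1 < q ^ d - 1"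
      using assms(2) by (simp add: diff_less_mono)
    then have "q ^ n - 1 = 0"
      using less.prems by (metis dvd_imp_le gr0I leD)
    then have "n = 0"
      using assms(2) by (metis diff_is_0_eq leD one_less_power gr0I)
    then show ?thesis by simp
  next
    case False
    then have "q ^ n = q ^ (n - d) * q ^ d"
      by (simp flip: power_add)
    moreover have "q ^ (n - d) \<ge> 1" "q ^ d \<ge> 1"
      using assms(2) by simp_all
    ultimately have "q ^ n - 1 = q ^ (n - d) * (q ^ d - 1) + (q ^ (n - d) - 1)"
      by (simp add: algebra_simps)
    then have "q ^ d - 1 dvd q ^ (n - d) - 1"
      using less.prems by (metis dvd_add_right_iff dvd_triv_right)
    then have "d dvd n - d"
      using less.IH[of "n - d"] False assms(3) by simp
    then show ?thesis
      using False by (metis dvd_diffD1 dvd_refl dvd_minus_self linorder_not_less)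
  qed
qed

context vector_space
begin

lemma card_span_independent:
  assumes "finite (UNIV :: 'a set)" "finite B" "independent B"
  shows "card (span B) = CARD('a) ^ card B"
  using assms(2,3)
proof (induction B rule: finite_induct)
  case (insert b B)
  then have B: "b \<notin> span B" "independent B"
    by (auto simp: independent_insert)
  have "bij_betw (\<lambda>(c, v). c *s b + v) (UNIV \<times> span B) (span (insert b B))"
  proof (rule bij_betwI')
    fix p p' :: "'a \<times> 'b" assume "p \<in> UNIV \<times> span B" "p' \<in> UNIV \<times> span B"
    then obtain c v c' v' where p: "p = (c, v)" "p' = (c', v')" and v: "v \<in> span B" "v' \<in> span B"
      by auto
    have "c = c'" if "c *s b + v = c' *s b + v'"
    proof (rule ccontr)
      assume "c \<noteq> c'"
      have "(c - c') *s b = v' - v"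
        using that by (simp add: algebra_simps)
      then have "(c - c') *s b \<in> span B"
        using v by (simp add: span_diff)
      then show False
        using \<open>c \<noteq> c'\<close> B(1) span_scale[of "(c - c') *s b" B "inverse (c - c')"] by simp
    qed
    then show "(case p of (c, v) \<Rightarrow> c *s b + v) = (case p' of (c, v) \<Rightarrow> c *s b + v) \<longleftrightarrow> p = p'"
      unfolding p by auto
  next
    fix p :: "'a \<times> 'b" assume "p \<in> UNIV \<times> span B"
    then show "(case p of (c, v) \<Rightarrow> c *s b + v) \<in> span (insert b B)"
      by (auto intro!: span_add span_scale intro: span_base span_mono[THEN subsetD])
  next
    fix w assume "w \<in> span (insert b B)"
    then obtain c where "w - c *s b \<in> span B"
      by (auto simp: span_insert)
    then show "\<exists>p\<in>UNIV \<times> span B. w = (case p of (c, v) \<Rightarrow> c *s b + v)"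
      by (intro bexI[of _ "(c, w - c *s b)"]) auto
  qed
  then show ?case
    using insert B by (simp flip: bij_betw_same_card add: card_cartesian_product)
qed simp

text \<open>The side condition rules out infinite-dimensional subspaces, for which
  \<open>dim\<close> is 0 by convention.\<close>

lemma card_subspace:
  assumes "finite (UNIV :: 'a set)" "subspace S" "dim S > 0 \<or> finite S"
  shows "card S = CARD('a) ^ dim S"
proof -
  obtain B where B: "B \<subseteq> S" "independent B" "S \<subseteq> span B" "card B = dim S"
    using basis_exists by blast
  have "finite B"
    using assms(3) B(1,4) by (metis card_gt_0_iff finite_subset)
  moreover have "span B = S"
    using B assms(2) by (simp add: span_subspace)
  ultimately show ?thesis
    using card_span_independent[of B] assms(1) B by simp
qed

end

section \<open>Subfields of an extension of prime degree\<close>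

text \<open>Being a vector space over the base field with \<open>q\<close> elements,
  \<open>S\<close> has \<open>q ^ d\<close> elements. The cosets of its nonzero part partition the
  nonzero elements of the big field, so \<open>q ^ d - 1\<close> divides \<open>q ^ n - 1\<close>.
  Hence \<open>d\<close> divides \<open>n\<close>, and primality leaves \<open>d = 1\<close> or
  \<open>d = n\<close>.\<close>

lemma subfield_trivial:
  fixes \<iota> :: "'a::field \<Rightarrow> 'k::field"
  assumes fin: "finite (UNIV :: 'k set)" and \<iota>: "field_embedding \<iota>"
    and card: "CARD('k) = CARD('a) ^ n" and n: "prime n"
    and S: "range \<iota> \<subseteq> S" "\<And>x y. x \<in> S \<Longrightarrow> y \<in> S \<Longrightarrow> x + y \<in> S"
      "\<And>x y. x \<in> S \<Longrightarrow> y \<in> S \<Longrightarrow> x * y \<in> S"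
  shows "S = range \<iota> \<or> S = UNIV"
proof -
  have \<iota>': "\<iota> 1 = 1" "\<And>x y. \<iota> (x + y) = \<iota> x + \<iota> y" "\<And>x y. \<iota> (x * y) = \<iota> x * \<iota> y"
    using \<iota> by (auto simp: field_embedding_def)
  interpret K: vector_space "\<lambda>c x. \<iota> c * x"
    by unfold_locales (auto simp: \<iota>' algebra_simps)
  have \<iota>0: "\<iota> 0 = 0"
    using \<iota>'(2)[of 0 0] by (metis add_0 add_right_cancel)
  have inj: "inj \<iota>"
  proof (rule injI, rule ccontr)
    fix x y assume *: "\<iota> x = \<iota> y" "x \<noteq> y"
    have "\<iota> x = \<iota> (x - y) + \<iota> y"
      by (simp flip: \<iota>'(2))
    then have "\<iota> (x - y) = 0"
      using * by simp
    then have "\<iota> ((x - y) * inverse (x - y)) = 0"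
      by (simp only: \<iota>'(3) mult_zero_left)
    then show False
      using * \<iota>' by simp
  qed
  have fina: "finite (UNIV :: 'a set)"
    using finite_subset[OF subset_UNIV fin, of "range \<iota>"] finite_imageD[OF _ inj] by simp
  have q: "CARD('a) > 1"
    using card_mono[OF fina, of "{0, 1}"] by simp
  have "\<iota> c \<in> S" for c
    using S(1) by blast
  then have "K.subspace S"
    unfolding K.subspace_def using S(2,3) \<iota>0 by metis
  moreover have finS: "finite S"
    by (rule finite_subset[OF subset_UNIV fin])
  ultimately have cardS: "card S = CARD('a) ^ K.dim S"
    using K.card_subspace[of S] fina by simp
  define d where "d = K.dim S"
  have "\<iota> 0 \<in> S" "\<iota> 1 \<in> S"
    using S(1) by auto
  then have S01: "0 \<in> S" "1 \<in> S"
    by (simp_all add: \<iota>0 \<iota>')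
  have "card S \<ge> 2"
    using card_mono[OF finS, of "{0, 1}"] S01 by simp
  then have d0: "d > 0"
    using cardS d_def by (intro gr0I) auto
  define S' where "S' = S - {0}"
  \<comment> \<open>Closure under inverses comes from finiteness: multiplication by an element of
    \<open>S'\<close> is injective on \<open>S'\<close>, hence permutes it.\<close>
  have surj: "(\<lambda>s. s * x) ` S' = S'" if "x \<in> S'" for x
  proof (rule endo_inj_surj)
    show "finite S'" using finS S'_def by simp
    show "(\<lambda>s. s * x) ` S' \<subseteq> S'"
      using that S S'_def by auto
    show "inj_on (\<lambda>s. s * x) S'"
      using that S'_def by (auto intro: inj_onI)
  qed
  have coset: "(\<lambda>s. s * (t * x)) ` S' = (\<lambda>s. s * x) ` S'" if "t \<in> S'" for t x
  proof -
    have "(\<lambda>s. s * (t * x)) ` S' = (\<lambda>s. s * x) ` (\<lambda>s. s * t) ` S'"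
      by (simp add: image_image mult.assoc)
    then show ?thesis
      by (simp only: surj[OF that])
  qed
  define \<C> where "\<C> = (\<lambda>x. (\<lambda>s. s * x) ` S') ` (UNIV - {0})"
  have "1 \<in> S'"
    using S01 S'_def by simp
  have un: "\<Union>\<C> = UNIV - {0}"
  proof
    show "\<Union>\<C> \<subseteq> UNIV - {0}"
      by (auto simp: \<C>_def S'_def)
    show "UNIV - {0} \<subseteq> \<Union>\<C>"
      using \<open>1 \<in> S'\<close> by (force simp: \<C>_def)
  qed
  have "(CARD('a) ^ d - 1) * card \<C> = card (\<Union>\<C>)"
  proof (rule card_partition)
    show "finite \<C>" "finite (\<Union>\<C>)"
      using finite_subset[OF subset_UNIV fin] by (auto simp: \<C>_def un)
    fix c assume "c \<in> \<C>"
    then obtain x where x: "x \<noteq> 0" "c = (\<lambda>s. s * x) ` S'"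
      by (auto simp: \<C>_def)
    then have "card c = card S'"
      by (auto intro!: card_image inj_onI)
    then show "card c = CARD('a) ^ d - 1"
      using cardS S01 finS by (simp add: S'_def d_def)
    fix c' assume c': "c' \<in> \<C>" "c \<noteq> c'"
    then obtain y where y: "y \<noteq> 0" "c' = (\<lambda>s. s * y) ` S'"
      by (auto simp: \<C>_def)
    show "c \<inter> c' = {}"
    proof (rule ccontr)
      assume "c \<inter> c' \<noteq> {}"
      then obtain s t where "s \<in> S'" "t \<in> S'" "s * x = t * y"
        using x y by auto
      then have "c = c'"
        using coset[of s x] coset[of t y] x y by simp
      then show False using c' by simp
    qed
  qed
  then have "CARD('a) ^ d - 1 dvd CARD('a) ^ n - 1"
    using un card fin by (metis dvd_triv_left card_Diff_singleton UNIV_I)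
  then have "d dvd n"
    using dvd_of_power_minus_one_dvd q d0 by blast
  then consider "d = 1" | "d = n"
    using n by (auto simp: prime_nat_iff)
  then show ?thesis
  proof cases
    case 1
    then have "card (range \<iota>) = card S"
      using cardS d_def card_image[OF inj] by simp
    then show ?thesis
      using S(1) finS card_subset_eq by blast
  next
    case 2
    then have "card S = CARD('k)"
      using cardS d_def card by simp
    then show ?thesis
      using fin card_subset_eq by blast
  qed
qed

section \<open>Line-preserving maps and additivity\<close>

text \<open>The restriction to fields with more than two elements is essential: over the field with two
  elements every injection maps lines to lines.\<close>

lemma collineation_additive:
  fixes s1 :: "'a::field \<Rightarrow> 'b::ab_group_add \<Rightarrow> 'b" and s2 :: "'a \<Rightarrow> 'c::ab_group_add \<Rightarrow> 'c"
  assumes "vector_space s1" "vector_space s2" and fin: "finite (UNIV :: 'a set)"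
    and card: "CARD('a) > 2" and inj: "inj f" and f0: "f 0 = 0"
    and line: "\<And>a b c. \<exists>c'. f (a + s1 c (b - a)) = f a + s2 c' (f b - f a)"
    and dim: "\<And>b. \<exists>e. e \<notin> range (\<lambda>c. s1 c b)"
  shows "f (a + b) = f a + f b"
proof -
  interpret V1: vector_space s1 by fact
  interpret V2: vector_space s2 by fact
  \<comment> \<open>By hypothesis the image of a line only lies inside a line; the parameter map
    \<open>\<gamma>\<close> is injective on a finite field, so the image is the whole line.\<close>
  have line_surj: "\<exists>c. f (a + s1 c (b - a)) = f a + s2 c' (f b - f a)" if "a \<noteq> b" for a b c'
  proof -
    define \<gamma> where "\<gamma> c = (SOME c'. f (a + s1 c (b - a)) = f a + s2 c' (f b - f a))" for c
    have \<gamma>: "f (a + s1 c (b - a)) = f a + s2 (\<gamma> c) (f b - f a)" for c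
      unfolding \<gamma>_def using line by (rule someI_ex)
    have "inj \<gamma>"
    proof (rule injI)
      fix c d assume "\<gamma> c = \<gamma> d"
      then have "s1 c (b - a) = s1 d (b - a)"
        using \<gamma>[of c] \<gamma>[of d] injD[OF inj, of "a + s1 c (b - a)" "a + s1 d (b - a)"] by simp
      then show "c = d"
        using that V1.scale_right_imp_eq[of "b - a" c d] by simp
    qed
    then have "surj \<gamma>"
      using fin finite_UNIV_inj_surj by blast
    then show ?thesis
      by (metis \<gamma> surjD)
  qed
  have ray: "\<exists>c'. f (s1 c b) = s2 c' (f b)" for b c
    using line[of 0 c b] f0 by simp
  have ray_surj: "\<exists>c. f (s1 c b) = s2 c' (f b)" for b c'
    using line_surj[of 0 b c'] f0 by (cases "b = 0") auto
  \<comment> \<open>A third scalar puts \<open>a + b\<close> on the line joining a multiple of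
    \<open>a\<close> to a multiple of \<open>b\<close>, and \<open>f\<close> is known on both
    rays.\<close>
  obtain s :: 'a where s: "s \<noteq> 0" "s \<noteq> 1"
  proof -
    have "\<not> UNIV \<subseteq> {0, 1 :: 'a}"
      using card_mono[of "{0, 1 :: 'a}" UNIV] card by auto
    then show ?thesis using that by blast
  qed
  have span: "\<exists>p r. f (a + b) = s2 p (f a) + s2 r (f b)" for a b
  proof -
    define a' b' where "a' = s1 (1 / s) a" and "b' = s1 (1 / (1 - s)) b"
    have "a' + s1 (1 - s) (b' - a') = s1 (1 - (1 - s)) a' + s1 (1 - s) b'"
      by (simp add: V1.scale_left_diff_distrib V1.scale_right_diff_distrib)
    also have "\<dots> = a + b"
      using s by (simp add: a'_def b'_def)
    finally obtain c where "f (a + b) = f a' + s2 c (f b' - f a')"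
      using line[of a' "1 - s" b'] by auto
    moreover obtain u v where "f a' = s2 u (f a)" "f b' = s2 v (f b)"
      using ray unfolding a'_def b'_def by meson
    ultimately have "f (a + b) = s2 (u - c * u) (f a) + s2 (c * v) (f b)"
      by (simp add: V2.scale_left_diff_distrib V2.scale_right_diff_distrib)
    then show ?thesis by blast
  qed
  \<comment> \<open>The points \<open>a + c b\<close> form a line parallel to the ray of
    \<open>b\<close> and disjoint from it. If \<open>p\<close> were not 1, the line joining
    \<open>f a\<close> and \<open>f (a + b)\<close> would meet the ray of \<open>f b\<close>, namely
    at the parameter \<open>c'\<close> where the coefficient of \<open>f a\<close> vanishes; both
    lines are full images, so the preimages would meet too.\<close>
  have coeff: "p = 1" if ab: "a \<notin> range (\<lambda>c. s1 c b)" and p: "f (a + b) = s2 p (f a) + s2 r (f b)"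
    for a b p r
  proof (rule ccontr)
    assume "p \<noteq> 1"
    have "a \<noteq> 0"
      using ab V1.scale_zero_left by (metis rangeI)
    then have "f a \<noteq> 0"
      using inj f0 by (metis injD)
    have "b \<noteq> 0"
    proof
      assume "b = 0"
      then have "s2 1 (f a) = s2 p (f a)"
        using p f0 by simp
      then show False
        using V2.scale_right_imp_eq \<open>f a \<noteq> 0\<close> \<open>p \<noteq> 1\<close> by blast
    qed
    define c' where "c' = - 1 / (p - 1)"
    have c': "c' * p = c' - 1"
      using \<open>p \<noteq> 1\<close> by (simp add: c'_def field_simps)
    have "f a + s2 c' (f (a + b) - f a) = s2 (1 + c' * p - c') (f a) + s2 (c' * r) (f b)"
      by (simp add: p V2.scale_left_diff_distrib V2.scale_right_diff_distrib V2.scale_left_distrib V2.scale_right_distrib)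
    then have "f a + s2 c' (f (a + b) - f a) = s2 (c' * r) (f b)"
      by (simp add: c')
    then obtain c where "f (a + s1 c b) = s2 (c' * r) (f b)"
      using line_surj[of a "a + b" c'] \<open>b \<noteq> 0\<close> by auto
    moreover obtain d where "f (s1 d b) = s2 (c' * r) (f b)"
      using ray_surj by blast
    ultimately have "a + s1 c b = s1 d b"
      using inj by (metis injD)
    then have "a = s1 (d - c) b"
      by (simp add: V1.scale_left_diff_distrib algebra_simps)
    then show False
      using ab by blast
  qed
  have indep: "f (a + b) = f a + f b" if "a \<notin> range (\<lambda>c. s1 c b)" "b \<notin> range (\<lambda>c. s1 c a)" for a b
  proof -
    obtain p r where pr: "f (a + b) = s2 p (f a) + s2 r (f b)"
      using span by blast
    then have "p = 1"
      using coeff that by blast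
    moreover have "r = 1"
      using coeff[of b a r p] that pr by (simp add: add.commute)
    ultimately show ?thesis
      using pr by simp
  qed
  have indep': "f (a + b) = f a + f b" if "a \<notin> range (\<lambda>c. s1 c b)" for a b
  proof (cases "b = 0")
    case False
    have "b \<notin> range (\<lambda>c. s1 c a)"
    proof
      assume "b \<in> range (\<lambda>c. s1 c a)"
      then obtain c where c: "b = s1 c a" by blast
      then have "a = s1 (1 / c) b"
        using False by auto
      then show False using that by blast
    qed
    then show ?thesis using indep that by blast
  qed (simp add: f0)
  show ?thesis
  proof (cases "a \<in> range (\<lambda>c. s1 c b)")
    case True
    then obtain c where c: "a = s1 c b" by blast
    \<comment> \<open>For dependent \<open>a\<close> and \<open>b\<close> a vector \<open>e\<close>
      off the ray of \<open>b\<close> helps: \<open>a + b + e\<close> is expanded in two ways into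
      sums of the kind already treated.\<close>
    obtain e where e: "e \<notin> range (\<lambda>c. s1 c b)"
      using dim by blast
    have "b + e \<notin> range (\<lambda>d. s1 d a)"
    proof
      assume "b + e \<in> range (\<lambda>d. s1 d a)"
      then obtain d where "e = s1 (d * c - 1) b"
        by (auto simp: c V1.scale_left_diff_distrib algebra_simps)
      then show False using e by blast
    qed
    moreover have "e \<notin> range (\<lambda>d. s1 d (a + b))"
    proof
      assume "e \<in> range (\<lambda>d. s1 d (a + b))"
      then obtain d where "e = s1 (d * c + d) b"
        by (auto simp: c V1.scale_left_distrib V1.scale_right_distrib)
      then show False using e by blast
    qed
    ultimately have "f (b + e + a) = f b + f e + f a" "f (e + (a + b)) = f e + f (a + b)"
      using indep' e by (metis add.commute)+
    then show ?thesis
      by (simp add: algebra_simps)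
  qed (rule indep')
qed

subsection \<open>Slopes in the quotient by an element\<close>

lemma pg_points_span: "P \<in> pg_points \<longleftrightarrow> (\<exists>p. p \<noteq> 0 \<and> P = range (\<lambda>c. c *s p))"
proof
  assume "P \<in> pg_points"
  then have P: "vec.subspace P" "vec.dim P = 1"
    by (auto simp: pg_points_def)
  obtain B where B: "B \<subseteq> P" "vec.independent B" "P \<subseteq> vec.span B" "card B = vec.dim P"
    using vec.basis_exists by blast
  then obtain p where p: "B = {p}"
    using P by (metis card_1_singletonE)
  then have "p \<noteq> 0"
    using B(2) by auto
  moreover have "P = vec.span {p}"
    using B P p vec.span_subspace by blast
  ultimately show "\<exists>p. p \<noteq> 0 \<and> P = range (\<lambda>c. c *s p)"
    by (auto simp: vec.span_singleton)
next
  assume "\<exists>p. p \<noteq> 0 \<and> P = range (\<lambda>c. c *s p)"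
  then obtain p where p: "p \<noteq> 0" "P = vec.span {p}"
    by (auto simp: vec.span_singleton)
  then show "P \<in> pg_points"
    by (simp add: pg_points_def)
qed

text \<open>Prepared for the induced spreads: a point given by an equation, not by a generator,
  pulls back directly to an equation on the vectors of the whole space.\<close>

lemma pg_points_2_iff:
  fixes P :: "('k::field ^ 2) set"
  shows "P \<in> pg_points \<longleftrightarrow> (\<exists>s t. (s \<noteq> 0 \<or> t \<noteq> 0) \<and> P = {p. s * p $ 1 = t * p $ 2})"
proof -
  have eq: "range (\<lambda>c. c *s p) = {v :: 'k ^ 2. p $ 2 * v $ 1 = p $ 1 * v $ 2}" if p: "p \<noteq> 0" for p :: "'k ^ 2"
  proof
    show "{v :: 'k ^ 2. p $ 2 * v $ 1 = p $ 1 * v $ 2} \<subseteq> range (\<lambda>c. c *s p)"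
    proof clarify
      fix v :: "'k ^ 2" assume v: "p $ 2 * v $ 1 = p $ 1 * v $ 2"
      consider "p $ 1 \<noteq> 0" | "p $ 2 \<noteq> 0"
        using p by (auto simp: vec_eq_iff forall_2)
      then show "v \<in> range (\<lambda>c. c *s p)"
      proof cases
        case 1
        then have "v = (v $ 1 / p $ 1) *s p"
          using v by (auto simp: vec_eq_iff forall_2 field_simps)
        then show ?thesis by blast
      next
        case 2
        then have "v = (v $ 2 / p $ 2) *s p"
          using v by (auto simp: vec_eq_iff forall_2 field_simps)
        then show ?thesis by blast
      qed
    qed
  qed (auto simp: mult_ac)
  show ?thesis
  proof
    assume "P \<in> pg_points"
    then obtain p :: "'k ^ 2" where "p \<noteq> 0" "P = range (\<lambda>c. c *s p)"
      by (auto simp: pg_points_span)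
    then have p: "p \<noteq> 0" "P = {v. p $ 2 * v $ 1 = p $ 1 * v $ 2}"
      by (simp_all add: eq)
    then have "p $ 2 \<noteq> 0 \<or> p $ 1 \<noteq> 0"
      by (auto simp: vec_eq_iff forall_2)
    then show "\<exists>s t. (s \<noteq> 0 \<or> t \<noteq> 0) \<and> P = {p. s * p $ 1 = t * p $ 2}"
      using p(2) by blast
  next
    assume "\<exists>s t. (s \<noteq> 0 \<or> t \<noteq> 0) \<and> P = {p. s * p $ 1 = t * p $ 2}"
    then obtain s t where st: "s \<noteq> 0 \<or> t \<noteq> 0" "P = {p. s * p $ 1 = t * p $ 2}"
      by blast
    define p :: "'k ^ 2" where "p = vector [t, s]"
    have "p \<noteq> 0" "P = range (\<lambda>c. c *s p)"
      using st eq[of p] by (auto simp: p_def vec_eq_iff forall_2)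
    then show "P \<in> pg_points"
      by (auto simp: pg_points_span)
  qed
qed

section \<open>Pseudo-hyperovals with at most one non-Desarguesian element\<close>

text \<open>The count of Desarguesian elements enters as \<open>bad_unique\<close>: of two distinct
  elements at least one induces a Desarguesian spread. The bound \<open>cardH\<close> provides a
  fourth element besides three coordinate spaces.\<close>

locale desarguesian_pseudo_hyperoval = vector_space smul
  for smul :: "'a::field \<Rightarrow> 'v::ab_group_add \<Rightarrow> 'v" (infixr \<open>\<odot>\<close> 75) +
  fixes \<iota> :: "'a \<Rightarrow> 'k::field" and n :: nat and H :: "'v set set"
  assumes emb: "field_embedding \<iota>"
    and arc: "pseudo_arc smul n H"
    and finK: "finite (UNIV :: 'k set)"
    and cardK: "CARD('k) = CARD('a) ^ n"
    and prime_n: "prime n"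
    and card_gt_2: "CARD('a) > 2"
    and char2: "(1::'k) + 1 = 0"
    and cardH: "card H \<ge> 4"
    and bad_unique: "\<And>E F. E \<in> H \<Longrightarrow> F \<in> H \<Longrightarrow> \<not> induces_desarguesian smul \<iota> H E \<Longrightarrow>
      \<not> induces_desarguesian smul \<iota> H F \<Longrightarrow> E = F"
begin

abbreviation good :: "'v set \<Rightarrow> bool" where
  "good \<equiv> induces_desarguesian smul \<iota> H"

abbreviation kscale :: "'a \<Rightarrow> 'k \<Rightarrow> 'k" where
  "kscale c x \<equiv> \<iota> c * x"

lemma \<iota>_simps: "\<iota> 1 = 1" "\<iota> (x + y) = \<iota> x + \<iota> y" "\<iota> (x * y) = \<iota> x * \<iota> y"
  using emb by (auto simp: field_embedding_def)

sublocale K: vector_space kscale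
  by unfold_locales (auto simp: \<iota>_simps algebra_simps)

lemma \<iota>_diff: "\<iota> (x - y) = \<iota> x - \<iota> y"
  by (metis \<iota>_simps(2) diff_add_cancel add_diff_cancel)

lemma inj_\<iota>: "inj \<iota>"
proof (rule injI, rule ccontr)
  fix x y assume *: "\<iota> x = \<iota> y" "x \<noteq> y"
  then have "\<iota> (x - y) * \<iota> (inverse (x - y)) = 0"
    by (simp add: \<iota>_diff)
  then show False
    using * \<iota>_simps(1) by (simp flip: \<iota>_simps(3))
qed

lemma finF: "finite (UNIV :: 'a set)"
  using finite_subset[OF subset_UNIV finK, of "range \<iota>"] finite_imageD[OF _ inj_\<iota>] by simp

lemma n_pos: "n > 0"
  using prime_n by (rule prime_gt_0_nat)

lemma subspace_H: "E \<in> H \<Longrightarrow> subspace E"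
  using arc by (simp add: pseudo_arc_def)

lemma card_H: "E \<in> H \<Longrightarrow> card E = CARD('k)"
  using arc card_subspace[of E] finF n_pos cardK by (simp add: pseudo_arc_def)

lemma pseudo_arcD:
  "E \<in> H \<Longrightarrow> F \<in> H \<Longrightarrow> G \<in> H \<Longrightarrow> E \<noteq> F \<Longrightarrow> E \<noteq> G \<Longrightarrow> F \<noteq> G \<Longrightarrow> span (E \<union> F) \<inter> G = {0}"
  using arc unfolding pseudo_arc_def by blast

text \<open>The arc condition concerns triples, so a third element \<open>G\<close> is adjoined:
  \<open>E\<close> lies in \<open>span (E \<union> G)\<close>, which meets \<open>F\<close>
  trivially.\<close>

lemma disjoint_H:
  assumes "E \<in> H" "F \<in> H" "E \<noteq> F" "v \<in> E" "v \<in> F"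
  shows "v = 0"
proof -
  have "\<not> H \<subseteq> {E, F}"
    using cardH card_mono[of "{E, F}" H] by (auto simp: card_insert_if split: if_splits)
  then obtain G where "G \<in> H" "G \<noteq> E" "G \<noteq> F"
    by blast
  then have "span (E \<union> G) \<inter> F = {0}"
    using assms pseudo_arcD by blast
  then show ?thesis
    using assms(4,5) span_base[of v "E \<union> G"] by auto
qed

lemma nonzero_H:
  assumes "E \<in> H" obtains v where "v \<in> E" "v \<noteq> 0"
proof -
  have "card E \<ge> 2"
    using card_H[OF assms] card_mono[OF finK, of "{0, 1}"] by simp
  then have "\<not> E \<subseteq> {0}"
    using card_mono[of "{0}" E] by auto
  then show ?thesis using that by blast
qed

lemma not_subset_span:
  assumes "E \<in> H" "F \<in> H" "G \<in> H" "E \<noteq> F" "E \<noteq> G" "F \<noteq> G"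
  shows "\<not> G \<subseteq> span (E \<union> F)"
  using pseudo_arcD[OF assms] nonzero_H[OF assms(3)] by blast

abbreviation lin :: "('v \<Rightarrow> 'k) \<Rightarrow> bool" where
  "lin \<equiv> module_hom smul kscale"

lemma linI:
  assumes "\<And>v w. \<rho> (v + w) = \<rho> v + \<rho> w" "\<And>c v. \<rho> (c \<odot> v) = \<iota> c * \<rho> v"
  shows "lin \<rho>"
  unfolding module_hom_iff using assms module_axioms K.module_axioms by blast

lemma lin_combination:
  assumes "lin \<rho>" "lin \<sigma>" shows "lin (\<lambda>v. s * \<rho> v - t * \<sigma> v)"
proof -
  interpret \<rho>: module_hom smul kscale \<rho> by fact
  interpret \<sigma>: module_hom smul kscale \<sigma> by fact
  show ?thesis
    by (rule linI) (simp_all add: \<rho>.add \<sigma>.add \<rho>.scale \<sigma>.scale algebra_simps)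
qed

text \<open>A vector is sent to its coset modulo \<open>E\<close> and then to a pair over the big
  field by the inverse of the field reduction; \<open>\<rho>\<close> and \<open>\<sigma>\<close> are
  the two entries. Points of the projective line become equations
  \<open>s * \<rho> v = t * \<sigma> v\<close>, and since the induced spread is Desarguesian, these
  cut out exactly the spaces \<open>span (E \<union> F)\<close>.\<close>

lemma good_pencil:
  assumes "E \<in> H" "good E"
  obtains \<rho> \<sigma> where "lin \<rho>" "lin \<sigma>" "\<And>v. v \<in> E \<longleftrightarrow> \<rho> v = 0 \<and> \<sigma> v = 0"
    "\<And>F. F \<in> H \<Longrightarrow> F \<noteq> E \<Longrightarrow> \<exists>s t. (s \<noteq> 0 \<or> t \<noteq> 0) \<and> span (E \<union> F) = {v. s * \<rho> v = t * \<sigma> v}"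
    "\<And>s t. s \<noteq> 0 \<or> t \<noteq> 0 \<Longrightarrow> \<exists>F\<in>H. F \<noteq> E \<and> span (E \<union> F) = {v. s * \<rho> v = t * \<sigma> v}"
proof -
  note E = subspace_H[OF assms(1)]
  note VS = vector_space_axioms
  obtain \<phi> :: "'k ^ 2 \<Rightarrow> 'v set" where
    iso: "field_reduction_iso \<iota> (cosets E UNIV) (+) (quotient_scale smul E) \<phi>" and
    spread: "induced_spread smul H E = field_reduction \<phi> pg_points"
    using assms(2) by (auto simp: induces_desarguesian_def desarguesian_spread_def)
  have bij: "bij_betw \<phi> UNIV (cosets E UNIV)"
    and add: "\<And>x y. \<phi> (x + y) = \<phi> x + \<phi> y"
    and scale: "\<And>c x. \<phi> (\<iota> c *s x) = quotient_scale smul E c (\<phi> x)"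
    using iso by (auto simp: field_reduction_iso_def)
  have inj: "inj \<phi>"
    using bij by (simp add: bij_betw_def)
  define \<pi> where "\<pi> v = inv \<phi> (v +o E)" for v
  have \<pi>: "\<phi> (\<pi> v) = v +o E" for v
    unfolding \<pi>_def using bij by (intro f_inv_into_f) (auto simp: bij_betw_def cosets_def)
  have \<pi>_eqI: "\<pi> v = p" if "\<phi> p = v +o E" for v p
    using \<pi>[of v] that inj_eq[OF inj, of "\<pi> v" p] by simp
  have \<pi>_add: "\<pi> (v + w) = \<pi> v + \<pi> w" for v w
    by (rule \<pi>_eqI) (simp add: add \<pi> coset_plus_coset[OF VS E])
  have \<pi>_scale: "\<pi> (c \<odot> v) = \<iota> c *s \<pi> v" for c v
    by (rule \<pi>_eqI) (simp add: scale \<pi> quotient_scale_coset[OF VS E])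
  have coset_iff: "v +o E = w +o E \<longleftrightarrow> v - w \<in> E" for v w
  proof
    assume "v +o E = w +o E"
    moreover have "v \<in> v +o E"
      using subspace_0[OF E] by (force simp: elt_set_plus_def)
    ultimately show "v - w \<in> E"
      by (auto simp: elt_set_plus_def)
  next
    assume *: "v - w \<in> E"
    have "v + e \<in> w +o E" if "e \<in> E" for e
      using subspace_add[OF E * that] by (auto simp: elt_set_plus_def intro!: bexI[of _ "v - w + e"])
    moreover have "w + e \<in> v +o E" if "e \<in> E" for e
      using subspace_diff[OF E that *] by (auto simp: elt_set_plus_def intro!: bexI[of _ "e - (v - w)"])
    ultimately show "v +o E = w +o E"
      by (auto simp: elt_set_plus_def)
  qed
  have \<pi>_0: "\<pi> 0 = 0"
    using \<pi>_add[of 0 0] by simp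
  have ker: "v \<in> E \<longleftrightarrow> \<pi> v = 0" for v
    using coset_iff[of v 0] \<pi>[of v] \<pi>[of 0] \<pi>_0 inj by (metis diff_zero injD)
  \<comment> \<open>As \<open>span (E \<union> F)\<close> is a union of cosets of \<open>E\<close>,
    membership can be tested on cosets.\<close>
  have in_span: "v \<in> span (E \<union> F) \<longleftrightarrow> \<pi> v \<in> P" if "cosets E (span (E \<union> F)) = \<phi> ` P" for v F P
  proof -
    have "\<pi> v \<in> P \<longleftrightarrow> v +o E \<in> cosets E (span (E \<union> F))"
      unfolding that \<pi>[symmetric] by (simp add: inj_image_mem_iff[OF inj])
    also have "\<dots> \<longleftrightarrow> v \<in> span (E \<union> F)"
    proof
      assume "v +o E \<in> cosets E (span (E \<union> F))"
      then obtain w where w: "w \<in> span (E \<union> F)" "v - w \<in> E"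
        by (auto simp: cosets_def coset_iff)
      then have "w + (v - w) \<in> span (E \<union> F)"
        by (intro span_add) (auto intro: span_base)
      then show "v \<in> span (E \<union> F)" by simp
    qed (auto simp: cosets_def)
    finally show ?thesis ..
  qed
  show thesis
  proof (rule that)
    show "lin (\<lambda>v. \<pi> v $ 1)" "lin (\<lambda>v. \<pi> v $ 2)"
      by (rule linI; simp add: \<pi>_add \<pi>_scale)+
    show "v \<in> E \<longleftrightarrow> \<pi> v $ 1 = 0 \<and> \<pi> v $ 2 = 0" for v
      by (simp add: ker vec_eq_iff forall_2)
  next
    fix F assume "F \<in> H" "F \<noteq> E"
    then have "cosets E (span (E \<union> F)) \<in> field_reduction \<phi> pg_points"
      unfolding spread[symmetric] induced_spread_def by blast
    then obtain P where P: "P \<in> pg_points" "cosets E (span (E \<union> F)) = \<phi> ` P"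
      by (auto simp: field_reduction_def)
    then obtain s t where "s \<noteq> 0 \<or> t \<noteq> 0" "P = {p. s * p $ 1 = t * p $ 2}"
      by (auto simp: pg_points_2_iff)
    moreover from this have "span (E \<union> F) = {v. s * \<pi> v $ 1 = t * \<pi> v $ 2}"
      using in_span[OF P(2)] by blast
    ultimately show "\<exists>s t. (s \<noteq> 0 \<or> t \<noteq> 0) \<and> span (E \<union> F) = {v. s * \<pi> v $ 1 = t * \<pi> v $ 2}"
      by blast
  next
    fix s t :: 'k assume st: "s \<noteq> 0 \<or> t \<noteq> 0"
    define P where "P = {p :: 'k ^ 2. s * p $ 1 = t * p $ 2}"
    have "P \<in> pg_points"
      unfolding P_def pg_points_2_iff using st by blast
    then have "\<phi> ` P \<in> induced_spread smul H E"
      unfolding spread field_reduction_def by blast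
    then obtain F where F: "F \<in> H" "F \<noteq> E" "cosets E (span (E \<union> F)) = \<phi> ` P"
      by (auto simp: induced_spread_def)
    then have "span (E \<union> F) = {v. s * \<pi> v $ 1 = t * \<pi> v $ 2}"
      using in_span[OF F(3)] unfolding P_def by blast
    then show "\<exists>F\<in>H. F \<noteq> E \<and> span (E \<union> F) = {v. s * \<pi> v $ 1 = t * \<pi> v $ 2}"
      using F by blast
  qed
qed

text \<open>Three points of a projective line can be moved to infinity, 0 and 1: a change of the
  coordinates from \<open>good_pencil\<close> gives \<open>F1\<close>, \<open>F2\<close>,
  \<open>F3\<close> these slopes. Every \<open>G\<close> other than \<open>E\<close> and
  \<open>F1\<close> then has a finite slope \<open>m\<close>, and every \<open>m\<close>
  occurs.\<close>

lemma good_slopes: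
  assumes H: "E \<in> H" "F1 \<in> H" "F2 \<in> H" "F3 \<in> H" and good: "good E"
    and ne: "F1 \<noteq> E" "F2 \<noteq> E" "F3 \<noteq> E" "F1 \<noteq> F2" "F1 \<noteq> F3" "F2 \<noteq> F3"
  obtains \<rho> \<sigma> where "lin \<rho>" "lin \<sigma>" "\<And>v. v \<in> E \<longleftrightarrow> \<rho> v = 0 \<and> \<sigma> v = 0"
    "\<And>v. v \<in> F1 \<Longrightarrow> \<rho> v = 0" "\<And>v. v \<in> F2 \<Longrightarrow> \<sigma> v = 0" "\<And>v. v \<in> F3 \<Longrightarrow> \<rho> v = \<sigma> v"
    "\<And>G. G \<in> H \<Longrightarrow> G \<noteq> E \<Longrightarrow> G \<noteq> F1 \<Longrightarrow> \<exists>m. span (E \<union> G) = {v. \<sigma> v = m * \<rho> v}"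
    "\<And>m. \<exists>G\<in>H. G \<noteq> E \<and> G \<noteq> F1 \<and> span (E \<union> G) = {v. \<sigma> v = m * \<rho> v}"
proof -
  obtain \<alpha> \<beta> where lin: "lin \<alpha>" "lin \<beta>" and ker: "\<And>v. v \<in> E \<longleftrightarrow> \<alpha> v = 0 \<and> \<beta> v = 0"
    and sp: "\<And>F. F \<in> H \<Longrightarrow> F \<noteq> E \<Longrightarrow> \<exists>s t. (s \<noteq> 0 \<or> t \<noteq> 0) \<and> span (E \<union> F) = {v. s * \<alpha> v = t * \<beta> v}"
    and sp': "\<And>s t. s \<noteq> 0 \<or> t \<noteq> 0 \<Longrightarrow> \<exists>F\<in>H. F \<noteq> E \<and> span (E \<union> F) = {v. s * \<alpha> v = t * \<beta> v}"
    by (fact good_pencil[OF H(1) good])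
  obtain s1 t1 where st1: "s1 \<noteq> 0 \<or> t1 \<noteq> 0" "span (E \<union> F1) = {v. s1 * \<alpha> v = t1 * \<beta> v}"
    using sp[OF H(2) ne(1)] by blast
  obtain s2 t2 where st2: "s2 \<noteq> 0 \<or> t2 \<noteq> 0" "span (E \<union> F2) = {v. s2 * \<alpha> v = t2 * \<beta> v}"
    using sp[OF H(3) ne(2)] by blast
  obtain s3 t3 where st3: "s3 \<noteq> 0 \<or> t3 \<noteq> 0" "span (E \<union> F3) = {v. s3 * \<alpha> v = t3 * \<beta> v}"
    using sp[OF H(4) ne(3)] by blast
  have sub: "G \<subseteq> span (E \<union> G)" for G
    by (auto intro: span_base)
  \<comment> \<open>Proportional coefficient pairs would give the same span, against the arc
    condition.\<close>
  have det: "s * t' - s' * t \<noteq> 0" if FG: "F \<in> H" "G \<in> H" "F \<noteq> E" "G \<noteq> E" "F \<noteq> G"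
    and st: "s \<noteq> 0 \<or> t \<noteq> 0" "span (E \<union> F) = {v. s * \<alpha> v = t * \<beta> v}"
    and st': "s' \<noteq> 0 \<or> t' \<noteq> 0" "span (E \<union> G) = {v. s' * \<alpha> v = t' * \<beta> v}" for F G s t s' t'
  proof
    assume 0: "s * t' - s' * t = 0"
    obtain c where c: "s' = c * s" "t' = c * t"
    proof (cases "s = 0")
      case True
      show ?thesis by (rule that[of "t' / t"]) (use True 0 st(1) in auto)
    next
      case False
      show ?thesis by (rule that[of "s' / s"]) (use False 0 st(1) in \<open>auto simp: field_simps\<close>)
    qed
    then have "span (E \<union> F) \<subseteq> span (E \<union> G)"
      unfolding st(2) st'(2) by (auto simp: mult.assoc)
    then show False
      using sub[of F] not_subset_span[OF H(1) FG(2,1)] FG by blast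
  qed
  define d where "d = s1 * t2 - s2 * t1"
  have d: "d \<noteq> 0"
    unfolding d_def by (rule det[OF H(2,3) ne(1,2,4) st1 st2])
  \<comment> \<open>By Cramer's rule these factors scale the equations of \<open>F1\<close> and
    \<open>F2\<close> so that the equation of \<open>F3\<close> becomes
    \<open>\<rho> v = \<sigma> v\<close>.\<close>
  define a b where "a = (s3 * t2 - s2 * t3) / d" and "b = (s3 * t1 - s1 * t3) / d"
  have "s3 * t2 - s2 * t3 \<noteq> 0" "s3 * t1 - s1 * t3 \<noteq> 0"
    using det[OF H(4,3) ne(3,2) _ st3 st2] det[OF H(4,2) ne(3,1) _ st3 st1] ne(5,6) by simp_all
  then have ab: "a \<noteq> 0" "b \<noteq> 0"
    using d by (simp_all add: a_def b_def)
  define \<rho> where "\<rho> v = a * s1 * \<alpha> v - a * t1 * \<beta> v" for v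
  define \<sigma> where "\<sigma> v = b * s2 * \<alpha> v - b * t2 * \<beta> v" for v
  have comb: "d * (s * \<alpha> v - t * \<beta> v) = (s * t2 - s2 * t) * (s1 * \<alpha> v - t1 * \<beta> v)
     - (s * t1 - s1 * t) * (s2 * \<alpha> v - t2 * \<beta> v)" for s t v
    by (simp add: d_def algebra_simps)
  have \<rho>\<sigma>: "\<rho> v = a * (s1 * \<alpha> v - t1 * \<beta> v)" "\<sigma> v = b * (s2 * \<alpha> v - t2 * \<beta> v)" for v
    by (simp_all add: \<rho>_def \<sigma>_def algebra_simps)
  have comb': "d * (s * \<alpha> v - t * \<beta> v) = (s * t2 - s2 * t) / a * \<rho> v - (s * t1 - s1 * t) / b * \<sigma> v" for s t v
    unfolding \<rho>\<sigma> comb using ab by simp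
  have iff: "s * \<alpha> v = t * \<beta> v \<longleftrightarrow> (s * t2 - s2 * t) / a * \<rho> v = (s * t1 - s1 * t) / b * \<sigma> v" for s t v
    using comb'[of s v t] d by (metis eq_iff_diff_eq_0 mult_eq_0_iff)
  show thesis
  proof (rule that)
    show "lin \<rho>" "lin \<sigma>"
      unfolding \<rho>_def \<sigma>_def using lin by (auto intro: lin_combination)
    show *: "v \<in> E \<longleftrightarrow> \<rho> v = 0 \<and> \<sigma> v = 0" for v
    proof
      assume "\<rho> v = 0 \<and> \<sigma> v = 0"
      then have "1 * \<alpha> v = 0 * \<beta> v" "0 * \<alpha> v = 1 * \<beta> v"
        unfolding iff by auto
      then show "v \<in> E" by (simp add: ker)
    qed (simp add: ker \<rho>_def \<sigma>_def)
    show F1: "\<rho> v = 0" if "v \<in> F1" for v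
      using sub[of F1] st1(2) that by (auto simp: \<rho>\<sigma>)
    show "\<sigma> v = 0" if "v \<in> F2" for v
      using sub[of F2] st2(2) that by (auto simp: \<rho>\<sigma>)
    show "\<rho> v = \<sigma> v" if "v \<in> F3" for v
    proof -
      have "s3 * \<alpha> v = t3 * \<beta> v"
        using sub[of F3] st3(2) that by auto
      then have "(s3 * t2 - s2 * t3) / a * \<rho> v = (s3 * t1 - s1 * t3) / b * \<sigma> v"
        by (simp add: iff)
      moreover have "(s3 * t2 - s2 * t3) / a = d" "(s3 * t1 - s1 * t3) / b = d"
        using ab d by (simp_all add: a_def b_def)
      ultimately show ?thesis
        using d by simp
    qed
    show "\<exists>m. span (E \<union> G) = {v. \<sigma> v = m * \<rho> v}" if G: "G \<in> H" "G \<noteq> E" "G \<noteq> F1" for G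
    proof -
      obtain s t where st: "s \<noteq> 0 \<or> t \<noteq> 0" "span (E \<union> G) = {v. s * \<alpha> v = t * \<beta> v}"
        using sp G by blast
      define u w where "u = (s * t2 - s2 * t) / a" and "w = (s * t1 - s1 * t) / b"
      have "w \<noteq> 0"
        using det[OF G(1) H(2) G(2) ne(1) G(3) st st1] ab by (simp add: w_def)
      then have "span (E \<union> G) = {v. \<sigma> v = u / w * \<rho> v}"
        unfolding st(2) iff u_def[symmetric] w_def[symmetric] by (auto simp: field_simps)
      then show ?thesis by blast
    qed
    show "\<exists>G\<in>H. G \<noteq> E \<and> G \<noteq> F1 \<and> span (E \<union> G) = {v. \<sigma> v = m * \<rho> v}" for m
    proof -
      define s t where "s = b * s2 - m * a * s1" and "t = b * t2 - m * a * t1"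
      have eq: "{v. s * \<alpha> v = t * \<beta> v} = {v. \<sigma> v = m * \<rho> v}"
        by (auto simp: s_def t_def \<rho>\<sigma> algebra_simps)
      have "s \<noteq> 0 \<or> t \<noteq> 0"
      proof (rule ccontr)
        assume "\<not> (s \<noteq> 0 \<or> t \<noteq> 0)"
        then have eqs: "b * s2 = m * a * s1" "b * t2 = m * a * t1"
          by (simp_all add: s_def t_def)
        have "b * d = s1 * (b * t2) - (b * s2) * t1"
          by (simp add: d_def algebra_simps)
        also have "\<dots> = 0"
          unfolding eqs by simp
        finally have "b * d = 0" .
        then show False using d ab by simp
      qed
      then obtain G where G: "G \<in> H" "G \<noteq> E" "span (E \<union> G) = {v. \<sigma> v = m * \<rho> v}"
        using sp'[of s t] eq by auto
      \<comment> \<open>On \<open>F1\<close> the map \<open>\<rho>\<close> vanishes, so a finite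
        slope would make \<open>\<sigma>\<close> vanish as well and put \<open>F1\<close> inside
        \<open>E\<close>.\<close>
      have "G \<noteq> F1"
      proof
        assume "G = F1"
        obtain v where v: "v \<in> F1" "v \<noteq> 0"
          using nonzero_H H by blast
        then have "v \<in> span (E \<union> G)"
          using \<open>G = F1\<close> sub by blast
        then have "\<sigma> v = m * \<rho> v"
          using G(3) by blast
        then have "v \<in> E"
          using F1 v * by simp
        then show False
          using disjoint_H H ne v by blast
      qed
      then show ?thesis using G by blast
    qed
  qed
qed

end

subsection \<open>Pseudo-hyperovals in coordinates\<close>

text \<open>By assumption \<open>k\<close> carries multiplication by \<open>p\<close> to
  multiplication by some \<open>\<psi> p\<close>. As \<open>\<psi>\<close> is injective on a finite
  field, it is surjective.\<close>

lemma scalings_surj: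
  fixes k :: "'k::field \<Rightarrow> 'k"
  assumes fin: "finite (UNIV :: 'k set)" and inj: "inj k"
    and scale: "\<And>p. \<exists>m. \<forall>s. k (p * s) = m * k s"
  shows "\<exists>p. \<forall>s. k (p * s) = m * k s"
proof -
  obtain \<psi> where \<psi>: "\<And>p s. k (p * s) = \<psi> p * k s"
    using scale by metis
  have "inj \<psi>"
  proof (rule injI)
    fix p p' assume "\<psi> p = \<psi> p'"
    then have "k (p * 1) = k (p' * 1)"
      by (simp only: \<psi>)
    then show "p = p'"
      using inj by (simp add: inj_eq)
  qed
  then have "surj \<psi>"
    using fin finite_UNIV_inj_surj by blast
  then obtain p where "m = \<psi> p"
    by blast
  then show ?thesis
    using \<psi> by blast
qed

text \<open>The index \<open>a\<close> is the slope seen from the space \<open>x = y = 0\<close>, so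
  \<open>y\<close> is a multiple of \<open>x\<close>; \<open>\<beta> a\<close> describes
  \<open>z\<close> and need not be a multiplication at first. \<open>\<beta>_1\<close> fixes the
  scale of \<open>z\<close> by the element of index 1.\<close>

locale hyperoval_coordinates = desarguesian_pseudo_hyperoval smul \<iota> n H
  for smul :: "'a::field \<Rightarrow> 'v::ab_group_add \<Rightarrow> 'v" (infixr \<open>\<odot>\<close> 75)
    and \<iota> :: "'a \<Rightarrow> 'k::field" and n H +
  fixes x y z :: "'v \<Rightarrow> 'k" and \<beta> :: "'k \<Rightarrow> 'k \<Rightarrow> 'k"
  assumes lin_xyz: "lin x" "lin y" "lin z"
    and coords_surj: "\<And>p q r. \<exists>v. x v = p \<and> y v = q \<and> z v = r"
    and coords_inj: "\<And>v w. x v = x w \<Longrightarrow> y v = y w \<Longrightarrow> z v = z w \<Longrightarrow> v = w"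
    and \<beta>_0: "\<And>s. \<beta> 0 s = 0" and \<beta>_1: "\<And>s. \<beta> 1 s = s"
    and H_eq: "H = {{v. x v = 0 \<and> z v = 0}, {v. x v = 0 \<and> y v = 0}} \<union>
      range (\<lambda>a. {v. y v = a * x v \<and> z v = \<beta> a (x v)})"
    and good_frame: "good {v. x v = 0 \<and> z v = 0}" "good {v. x v = 0 \<and> y v = 0}"
      "good {v. y v = 0 \<and> z v = 0}"
begin

sublocale x: module_hom smul kscale x by (fact lin_xyz)
sublocale y: module_hom smul kscale y by (fact lin_xyz)
sublocale z: module_hom smul kscale z by (fact lin_xyz)

definition B where "B = {v. x v = 0 \<and> z v = 0}"
definition C where "C = {v. x v = 0 \<and> y v = 0}"
definition E where "E a = {v. y v = a * x v \<and> z v = \<beta> a (x v)}"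

definition vec where "vec p q r = (SOME v. x v = p \<and> y v = q \<and> z v = r)"

lemma xyz_vec [simp]: "x (vec p q r) = p" "y (vec p q r) = q" "z (vec p q r) = r"
  using someI_ex[OF coords_surj[of p q r]] by (simp_all add: vec_def)

lemma vec_eqI: "x v = p \<Longrightarrow> y v = q \<Longrightarrow> z v = r \<Longrightarrow> v = vec p q r"
  by (rule coords_inj) simp_all

lemma vec_add: "vec p q r + vec p' q' r' = vec (p + p') (q + q') (r + r')"
  by (rule vec_eqI) (simp_all add: x.add y.add z.add)

lemma vec_scale: "c \<odot> vec p q r = vec (\<iota> c * p) (\<iota> c * q) (\<iota> c * r)"
  by (rule vec_eqI) (simp_all add: x.scale y.scale z.scale)

lemma mem_BCE:
  "v \<in> B \<longleftrightarrow> x v = 0 \<and> z v = 0" "v \<in> C \<longleftrightarrow> x v = 0 \<and> y v = 0"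
  "v \<in> E a \<longleftrightarrow> y v = a * x v \<and> z v = \<beta> a (x v)"
  by (simp_all add: B_def C_def E_def)

lemma H_eq': "H = {B, C} \<union> range E"
  using H_eq by (simp add: B_def C_def E_def[abs_def])

lemma in_H [simp]: "B \<in> H" "C \<in> H" "E a \<in> H"
  by (simp_all add: H_eq')

lemma E_0: "E 0 = {v. y v = 0 \<and> z v = 0}"
  by (simp add: E_def \<beta>_0)

lemma good_BCE [simp]: "good B" "good C" "good (E 0)"
  using good_frame by (simp_all add: B_def C_def E_0)

lemma BCE_neq [simp]: "B \<noteq> C" "C \<noteq> B" "E a \<noteq> B" "B \<noteq> E a" "E a \<noteq> C" "C \<noteq> E a"
proof -
  have "vec 0 1 0 \<in> B" "vec 0 1 0 \<notin> C"
    by (simp_all add: mem_BCE)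
  then show "B \<noteq> C" "C \<noteq> B" by auto
  have "vec 1 a (\<beta> a 1) \<in> E a" "vec 1 a (\<beta> a 1) \<notin> B" "vec 1 a (\<beta> a 1) \<notin> C"
    by (simp_all add: mem_BCE)
  then show "E a \<noteq> B" "B \<noteq> E a" "E a \<noteq> C" "C \<noteq> E a" by auto
qed

lemma E_eq_iff [simp]: "E a = E b \<longleftrightarrow> a = b"
proof
  assume "E a = E b"
  moreover have "vec 1 a (\<beta> a 1) \<in> E a"
    by (simp add: mem_BCE)
  ultimately show "a = b"
    by (simp add: mem_BCE)
qed simp

lemma vec_in_E: "vec s (a * s) (\<beta> a s) \<in> E a"
  by (simp add: mem_BCE)

lemma \<beta>_add: "\<beta> a (s + t) = \<beta> a s + \<beta> a t"
  using subspace_add[OF subspace_H vec_in_E vec_in_E, of a s t] by (simp add: mem_BCE x.add z.add)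

lemma \<beta>_scale: "\<beta> a (\<iota> c * s) = \<iota> c * \<beta> a s"
  using subspace_scale[OF subspace_H vec_in_E, of a c s] by (simp add: mem_BCE x.scale z.scale)

lemma \<beta>_zero: "\<beta> a 0 = 0"
  using \<beta>_add[of a 0 0] by (metis add_0 add_right_cancel)

text \<open>The summands lie in \<open>E a\<close>, \<open>B\<close> and \<open>C\<close>, so a
  linear map that vanishes on some of these spaces depends only on the remaining summands.\<close>

lemma decompose:
  "v = vec (x v) (a * x v) (\<beta> a (x v)) + vec 0 (y v - a * x v) 0 + vec 0 0 (z v - \<beta> a (x v))"
  unfolding vec_add by (rule vec_eqI) simp_all

section \<open>Slopes seen from \<open>B\<close> and from \<open>E a\<close>\<close>

text \<open>In the quotient by \<open>B\<close>, the map \<open>\<rho>\<close> vanishes on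
  \<open>B\<close> and \<open>C\<close> and so depends on \<open>x\<close> only, while
  \<open>\<sigma>\<close> vanishes on \<open>B\<close> and \<open>E 0\<close> and depends on
  \<open>z\<close> only. They agree on \<open>E 1\<close>, hence both are given by one map
  \<open>g\<close>. The slope equation of \<open>E a\<close> then says that \<open>g\<close>
  conjugates \<open>\<beta> a\<close> to multiplication by \<open>\<mu> a\<close>.\<close>

lemma slopes_at_B:
  obtains g \<mu> where "\<And>s t. g (s + t) = g s + g t" "\<And>c s. g (\<iota> c * s) = \<iota> c * g s" "inj g" "inj \<mu>"
    "\<And>a s. g (\<beta> a s) = \<mu> a * g s"
proof -
  have H: "B \<in> H" "C \<in> H" "E 0 \<in> H" "E 1 \<in> H" "good B"
    "C \<noteq> B" "E 0 \<noteq> B" "E 1 \<noteq> B" "C \<noteq> E 0" "C \<noteq> E 1" "E 0 \<noteq> E 1"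
    by simp_all
  obtain \<rho> \<sigma> where lin: "lin \<rho>" "lin \<sigma>" and ker: "\<And>v. v \<in> B \<longleftrightarrow> \<rho> v = 0 \<and> \<sigma> v = 0"
    and \<rho>\<sigma>: "\<And>v. v \<in> C \<Longrightarrow> \<rho> v = 0" "\<And>v. v \<in> E 0 \<Longrightarrow> \<sigma> v = 0" "\<And>v. v \<in> E 1 \<Longrightarrow> \<rho> v = \<sigma> v"
    and slope: "\<And>G. G \<in> H \<Longrightarrow> G \<noteq> B \<Longrightarrow> G \<noteq> C \<Longrightarrow> \<exists>m. span (B \<union> G) = {v. \<sigma> v = m * \<rho> v}"
    and "\<And>m. \<exists>G\<in>H. G \<noteq> B \<and> G \<noteq> C \<and> span (B \<union> G) = {v. \<sigma> v = m * \<rho> v}"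
    by (fact good_slopes[OF H])
  interpret \<rho>: module_hom smul kscale \<rho> by fact
  interpret \<sigma>: module_hom smul kscale \<sigma> by fact
  define g where "g s = \<rho> (vec s 0 0)" for s
  have "\<exists>m. span (B \<union> E a) = {v. \<sigma> v = m * \<rho> v}" for a
    by (rule slope) simp_all
  then obtain \<mu> where \<mu>: "\<And>a. span (B \<union> E a) = {v. \<sigma> v = \<mu> a * \<rho> v}"
    by metis
  have \<rho>g: "\<rho> v = g (x v)" for v
  proof -
    have "\<rho> v = g (x v) + \<rho> (vec 0 (y v) 0) + \<rho> (vec 0 0 (z v))"
      by (subst decompose[of v 0]) (simp add: \<rho>.add g_def \<beta>_0)
    moreover have "\<rho> (vec 0 (y v) 0) = 0" "\<rho> (vec 0 0 (z v)) = 0"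
      using ker[of "vec 0 (y v) 0"] \<rho>\<sigma>(1) by (simp_all add: mem_BCE)
    ultimately show ?thesis by simp
  qed
  have \<sigma>z: "\<sigma> v = \<sigma> (vec 0 0 (z v))" for v
  proof -
    have "\<sigma> v = \<sigma> (vec (x v) 0 0) + \<sigma> (vec 0 (y v) 0) + \<sigma> (vec 0 0 (z v))"
      by (subst decompose[of v 0]) (simp add: \<sigma>.add \<beta>_0)
    moreover have "\<sigma> (vec 0 (y v) 0) = 0" "\<sigma> (vec (x v) 0 0) = 0"
      using ker[of "vec 0 (y v) 0"] \<rho>\<sigma>(2) by (simp_all add: mem_BCE \<beta>_0)
    ultimately show ?thesis by simp
  qed
  have \<sigma>g: "\<sigma> v = g (z v)" for v
  proof -
    \<comment> \<open>This vector lies in \<open>E 1\<close>, as \<open>\<beta> 1\<close> is the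
      identity, and shares its \<open>z\<close>-coordinate with \<open>v\<close>.\<close>
    define w where "w = vec (z v) (z v) (z v)"
    have "\<sigma> v = \<sigma> w"
      using \<sigma>z[of v] \<sigma>z[of w] by (simp only: w_def xyz_vec)
    also have "\<dots> = \<rho> w"
      using \<rho>\<sigma>(3)[of w] by (simp add: w_def mem_BCE \<beta>_1)
    finally show ?thesis
      by (simp add: \<rho>g w_def)
  qed
  show thesis
  proof (rule that)
    show "g (s + t) = g s + g t" for s t
      by (simp add: g_def vec_add flip: \<rho>.add)
    then interpret g: Modules.additive g
      by unfold_locales
    show "g (\<iota> c * s) = \<iota> c * g s" for c s
      using \<rho>.scale[of c "vec s 0 0"] by (simp add: g_def vec_scale)
    show "inj g"
    proof (rule injI)
      fix s t assume "g s = g t"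
      then have "vec (s - t) 0 0 \<in> B"
        by (simp add: ker \<rho>g \<sigma>g g.diff g.zero)
      then show "s = t"
        by (simp add: mem_BCE)
    qed
    show "g (\<beta> a s) = \<mu> a * g s" for a s
    proof -
      have "vec s (a * s) (\<beta> a s) \<in> span (B \<union> E a)"
        using vec_in_E by (intro span_base) simp
      then show ?thesis
        by (simp add: \<mu> \<rho>g \<sigma>g)
    qed
    show "inj \<mu>"
    proof (rule injI, rule ccontr)
      fix a b assume "\<mu> a = \<mu> b" "a \<noteq> b"
      then have "span (B \<union> E a) = span (B \<union> E b)"
        by (simp add: \<mu>)
      moreover have "E b \<subseteq> span (B \<union> E b)"
        by (auto intro: span_base)
      ultimately show False
        using not_subset_span[of B "E a" "E b"] \<open>a \<noteq> b\<close> by simp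
    qed
  qed
qed

text \<open>With \<open>C\<close>, \<open>B\<close>, \<open>E b\<close> at the slopes infinity, 0
  and 1, \<open>\<rho>\<close> becomes a function \<open>k1\<close> of \<open>y v - a * x v\<close>
  and \<open>\<sigma>\<close> a function \<open>k2\<close> of \<open>z v - \<beta> a (x v)\<close>.
  The last two equations are the slope equations of \<open>E b\<close> and
  \<open>E d\<close>.\<close>

lemma slopes_at_E:
  assumes good: "good (E a)" and ab: "a \<noteq> b"
  obtains k2 k1 m where "\<And>s t. k2 (s + t) = k2 s + k2 t" "\<And>c s. k2 (\<iota> c * s) = \<iota> c * k2 s" "inj k2"
    "\<And>s. k2 (\<beta> b s - \<beta> a s) = k1 ((b - a) * s)"
    "\<And>d s. k2 (\<beta> d s - \<beta> a s) = m d * k1 ((d - a) * s)"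
proof -
  have H: "E a \<in> H" "C \<in> H" "B \<in> H" "E b \<in> H" "good (E a)"
    "C \<noteq> E a" "B \<noteq> E a" "E b \<noteq> E a" "C \<noteq> B" "C \<noteq> E b" "B \<noteq> E b"
    using assms by simp_all
  obtain \<rho> \<sigma> where lin: "lin \<rho>" "lin \<sigma>" and ker: "\<And>v. v \<in> E a \<longleftrightarrow> \<rho> v = 0 \<and> \<sigma> v = 0"
    and \<rho>\<sigma>: "\<And>v. v \<in> C \<Longrightarrow> \<rho> v = 0" "\<And>v. v \<in> B \<Longrightarrow> \<sigma> v = 0" "\<And>v. v \<in> E b \<Longrightarrow> \<rho> v = \<sigma> v"
    and slope: "\<And>G. G \<in> H \<Longrightarrow> G \<noteq> E a \<Longrightarrow> G \<noteq> C \<Longrightarrow> \<exists>m. span (E a \<union> G) = {v. \<sigma> v = m * \<rho> v}"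
    and "\<And>m. \<exists>G\<in>H. G \<noteq> E a \<and> G \<noteq> C \<and> span (E a \<union> G) = {v. \<sigma> v = m * \<rho> v}"
    by (fact good_slopes[OF H])
  interpret \<rho>: module_hom smul kscale \<rho> by fact
  interpret \<sigma>: module_hom smul kscale \<sigma> by fact
  define k1 where "k1 s = \<rho> (vec 0 s 0)" for s
  define k2 where "k2 s = \<sigma> (vec 0 0 s)" for s
  have \<rho>k: "\<rho> v = k1 (y v - a * x v)" for v
  proof -
    have "\<rho> (vec (x v) (a * x v) (\<beta> a (x v))) = 0"
      using ker vec_in_E by blast
    moreover have "\<rho> (vec 0 0 (z v - \<beta> a (x v))) = 0"
      using \<rho>\<sigma>(1) by (simp add: mem_BCE)
    ultimately show ?thesis
      by (subst decompose[of v a]) (simp add: \<rho>.add k1_def)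
  qed
  have \<sigma>k: "\<sigma> v = k2 (z v - \<beta> a (x v))" for v
  proof -
    have "\<sigma> (vec (x v) (a * x v) (\<beta> a (x v))) = 0"
      using ker vec_in_E by blast
    moreover have "\<sigma> (vec 0 (y v - a * x v) 0) = 0"
      using \<rho>\<sigma>(2) by (simp add: mem_BCE)
    ultimately show ?thesis
      by (subst decompose[of v a]) (simp add: \<sigma>.add k2_def)
  qed
  have "\<exists>m. \<forall>v\<in>E d. \<sigma> v = m * \<rho> v" for d
  proof (cases "d = a")
    case True
    then show ?thesis by (simp add: ker)
  next
    case False
    then obtain m where m: "span (E a \<union> E d) = {v. \<sigma> v = m * \<rho> v}"
      using slope[of "E d"] by auto
    have "E d \<subseteq> span (E a \<union> E d)"
      by (auto intro: span_base)
    then show ?thesis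
      using m by blast
  qed
  then obtain m where m: "\<And>d v. v \<in> E d \<Longrightarrow> \<sigma> v = m d * \<rho> v"
    by metis
  show thesis
  proof (rule that)
    show "k2 (s + t) = k2 s + k2 t" for s t
      by (simp add: k2_def vec_add flip: \<sigma>.add)
    then interpret k2: Modules.additive k2
      by unfold_locales
    show "k2 (\<iota> c * s) = \<iota> c * k2 s" for c s
      using \<sigma>.scale[of c "vec 0 0 s"] by (simp add: k2_def vec_scale)
    show "inj k2"
    proof (rule injI)
      fix s t assume "k2 s = k2 t"
      then have "\<sigma> (vec 0 0 (s - t)) = 0" "\<rho> (vec 0 0 (s - t)) = 0"
        using \<rho>\<sigma>(1) by (simp_all add: \<sigma>k \<beta>_zero k2.diff mem_BCE)
      then have "vec 0 0 (s - t) \<in> E a"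
        by (simp add: ker)
      then show "s = t"
        by (simp add: mem_BCE \<beta>_zero)
    qed
    show "k2 (\<beta> b s - \<beta> a s) = k1 ((b - a) * s)" for s
      using \<rho>\<sigma>(3)[OF vec_in_E[of s b]] by (simp add: \<rho>k \<sigma>k left_diff_distrib)
    show "k2 (\<beta> d s - \<beta> a s) = m d * k1 ((d - a) * s)" for d s
      using m[OF vec_in_E[of s d]] by (simp add: \<rho>k \<sigma>k left_diff_distrib)
  qed
qed

section \<open>Fields of slopes and additivity\<close>

text \<open>Elementarity in coordinates: \<open>E a\<close> then consists of the multiples of
  \<open>(1, a, p)\<close> over the big field.\<close>

definition multiplicative :: bool where
  "multiplicative \<longleftrightarrow> (\<forall>a. \<exists>p. \<forall>s. \<beta> a s = p * s)"

text \<open>The matrices \<open>\<beta> a\<close> form a field, and so do the slopes in the quotient by \<open>E a\<close>. As \<open>n\<close> is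
  prime, the two fields either meet in the scalars, which puts the images of collinear points on a
  line, or coincide, in which case they also contain all multiplications.\<close>

lemma \<mu>_line:
  assumes g: "\<And>s t. g (s + t) = g s + g t" "\<And>c s. g (\<iota> c * s) = \<iota> c * g s" "inj g"
    and \<mu>: "inj \<mu>" "\<And>a s. g (\<beta> a s) = \<mu> a * g s"
    and good: "good (E a)" and ab: "a \<noteq> b" and nonmult: "\<not> multiplicative"
  shows "\<exists>c'. \<mu> (a + \<iota> c * (b - a)) = \<mu> a + \<iota> c' * (\<mu> b - \<mu> a)"
proof -
  obtain k2 k1 m where k2: "\<And>s t. k2 (s + t) = k2 s + k2 t" "\<And>c s. k2 (\<iota> c * s) = \<iota> c * k2 s" "inj k2"
    and kb: "\<And>s. k2 (\<beta> b s - \<beta> a s) = k1 ((b - a) * s)"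
    and kd: "\<And>d s. k2 (\<beta> d s - \<beta> a s) = m d * k1 ((d - a) * s)"
    by (fact slopes_at_E[OF good ab])
  interpret g: Modules.additive g
    using g(1) by unfold_locales
  interpret k2: Modules.additive k2
    using k2(1) by unfold_locales
  have "surj g"
    using g(3) finK finite_UNIV_inj_surj by blast
  define h where "h = inv g"
  have gh: "g (h s) = s" and hg: "h (g s) = s" for s
    using \<open>surj g\<close> g(3) by (simp_all add: h_def surj_f_inv_f)
  have h_eqI: "h t = s" if "g s = t" for s t
    using that hg by blast
  \<comment> \<open>The intersection of two fields of maps: multiplications conjugated by
    \<open>g\<close> that are at the same time multiplications conjugated by
    \<open>k2\<close>.\<close>
  define S where "S = {t. \<exists>m. \<forall>s. k2 (h (t * g s)) = m * k2 s}"
  have S_cases: "S = range \<iota> \<or> S = UNIV"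
  proof (rule subfield_trivial[OF finK emb cardK prime_n])
    show "range \<iota> \<subseteq> S"
    proof clarify
      fix c
      have "k2 (h (\<iota> c * g s)) = \<iota> c * k2 s" for s
        by (simp add: hg k2(2) flip: g(2))
      then show "\<iota> c \<in> S"
        by (auto simp: S_def)
    qed
  next
    fix t t' assume "t \<in> S" "t' \<in> S"
    then obtain m m' where m: "\<And>s. k2 (h (t * g s)) = m * k2 s" "\<And>s. k2 (h (t' * g s)) = m' * k2 s"
      by (auto simp: S_def)
    have "h ((t + t') * g s) = h (t * g s) + h (t' * g s)" for s
      by (rule h_eqI) (simp add: g.add gh distrib_right)
    then have "k2 (h ((t + t') * g s)) = (m + m') * k2 s" for s
      by (simp add: k2.add m distrib_right)
    then show "t + t' \<in> S"
      by (auto simp: S_def)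
    have "k2 (h (t * t' * g s)) = m * m' * k2 s" for s
      using m(1)[of "h (t' * g s)"] by (simp add: m(2) gh mult.assoc)
    then show "t * t' \<in> S"
      by (auto simp: S_def)
  qed
  define e where "e = \<mu> b - \<mu> a"
  define \<delta> where "\<delta> s = \<beta> b s - \<beta> a s" for s
  have e: "e \<noteq> 0"
    using ab \<mu>(1) by (simp add: e_def inj_eq)
  have g\<delta>: "g (\<delta> s) = e * g s" for s
    by (simp add: \<delta>_def e_def g.diff \<mu>(2) left_diff_distrib)
  \<comment> \<open>\<open>d p\<close> is the point with parameter \<open>p\<close> on the line
    through \<open>a\<close> and \<open>b\<close>, and \<open>t p\<close> is the matching parameter
    among the slopes \<open>\<mu>\<close>. The goal is that \<open>t (\<iota> c)\<close> lies in the
    base field.\<close>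
  define d where "d p = a + p * (b - a)" for p
  define t where "t p = (\<mu> (d p) - \<mu> a) / e" for p
  \<comment> \<open>The value of \<open>k2\<close> at \<open>\<beta> (d p) s - \<beta> a s\<close>
    is expressed both by the slopes at \<open>B\<close> and by those at \<open>E a\<close>.\<close>
  have main: "k2 (h (t p * g (\<delta> s))) = m (d p) * k2 (\<delta> (p * s))" for p s
  proof -
    have "t p * e = \<mu> (d p) - \<mu> a"
      using e by (simp add: t_def)
    then have "h (t p * g (\<delta> s)) = \<beta> (d p) s - \<beta> a s"
      by (intro h_eqI) (simp add: g.diff \<mu>(2) g\<delta> left_diff_distrib flip: mult.assoc)
    then have "k2 (h (t p * g (\<delta> s))) = m (d p) * k1 ((b - a) * (p * s))"
      by (simp add: kd d_def mult_ac)
    then show ?thesis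
      by (simp add: \<delta>_def kb)
  qed
  from S_cases show ?thesis
  proof
    assume S: "S = range \<iota>"
    \<comment> \<open>For \<open>p\<close> in the base field, \<open>\<delta>\<close> commutes with
      multiplication by \<open>p\<close>; since \<open>\<delta>\<close> is onto, \<open>main\<close>
      shows that \<open>t p\<close> belongs to \<open>S\<close>.\<close>
    have "k2 (h (t (\<iota> c) * g s)) = m (d (\<iota> c)) * \<iota> c * k2 s" for s
    proof -
      obtain r where r: "s = \<delta> r"
      proof (rule that)
        have "g (\<delta> (h (g s / e))) = g s"
          using e by (simp add: g\<delta> gh)
        then show "s = \<delta> (h (g s / e))"
          using g(3) by (simp add: inj_eq)
      qed
      have "\<delta> (\<iota> c * r) = \<iota> c * \<delta> r"
        by (simp add: \<delta>_def \<beta>_scale right_diff_distrib)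
      then show ?thesis
        using main[of "\<iota> c" r] by (simp add: r k2(2))
    qed
    then have "t (\<iota> c) \<in> S"
      by (auto simp: S_def)
    then obtain c' where "t (\<iota> c) = \<iota> c'"
      using S by blast
    then have "\<mu> (a + \<iota> c * (b - a)) = \<mu> a + \<iota> c' * (\<mu> b - \<mu> a)"
      using e by (simp add: t_def d_def e_def[symmetric] field_simps)
    then show ?thesis ..
  next
    assume S: "S = UNIV"
    then have Sm: "\<exists>m. \<forall>s. k2 (h (t * g s)) = m * k2 s" for t
      by (auto simp: S_def)
    obtain m2 where "\<And>s. k2 (h (e * g s)) = m2 * k2 s"
      using Sm by blast
    then have m2: "k2 (\<delta> s) = m2 * k2 s" for s
      by (simp add: hg flip: g\<delta>)
    have nz: "k2 s \<noteq> 0" if "s \<noteq> 0" for s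
      using k2(3) that k2.zero by (metis injD)
    have "m2 \<noteq> 0"
    proof
      assume "m2 = 0"
      then have "k2 (\<delta> 1) = k2 0"
        by (simp add: m2 k2.zero)
      then have "g (\<delta> 1) = g 0"
        using k2(3) by (simp add: inj_eq)
      then show False
        using g(3) e g\<delta>[of 1] by (metis g.zero injD mult_eq_0_iff zero_neq_one)
    qed
    \<comment> \<open>Now every \<open>g\<close>-conjugate of a multiplication,
      \<open>\<delta>\<close> included, becomes a multiplication under \<open>k2\<close>. What
      \<open>main\<close> leaves over is the same statement for multiplication by \<open>p\<close>
      itself.\<close>
    have scal: "\<exists>m3. \<forall>s. k2 (p * s) = m3 * k2 s" for p
    proof (cases "p = 0")
      case True
      then show ?thesis by (auto simp: k2.zero)
    next
      case False
      obtain m1 where m1: "\<And>s. k2 (h (t p * g s)) = m1 * k2 s"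
        using Sm by blast
      have eq: "m1 * m2 * k2 s = m (d p) * m2 * k2 (p * s)" for s
        using main[of p s] by (simp add: m1 m2 mult.assoc)
      have "t p \<noteq> 0"
        using False ab e \<mu>(1) by (simp add: t_def d_def inj_eq)
      have "m1 \<noteq> 0"
      proof
        assume "m1 = 0"
        then have "h (t p * g 1) = 0"
          using m1[of 1] nz by fastforce
        then have "t p * g 1 = 0"
          by (metis gh g.zero)
        then show False
          using \<open>t p \<noteq> 0\<close> g(3) g.zero by (metis injD mult_eq_0_iff zero_neq_one)
      qed
      then have "m (d p) \<noteq> 0"
        using eq[of 1] \<open>m2 \<noteq> 0\<close> nz[of 1] by auto
      then have "k2 (p * s) = m1 / m (d p) * k2 s" for s
        using eq[of s] \<open>m2 \<noteq> 0\<close> by (simp add: field_simps)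
      then show ?thesis by blast
    qed
    \<comment> \<open>Under \<open>k2\<close> both \<open>\<beta> a'\<close> and, by
      \<open>scal\<close>, the multiplications become multiplications; \<open>scalings_surj\<close>
      finds one of the latter that equals \<open>\<beta> a'\<close>.\<close>
    have "\<exists>p. \<forall>s. \<beta> a' s = p * s" for a'
    proof -
      obtain m4 where "\<And>s. k2 (h (\<mu> a' * g s)) = m4 * k2 s"
        using Sm by blast
      then have m4: "k2 (\<beta> a' s) = m4 * k2 s" for s
        by (simp add: hg flip: \<mu>(2))
      obtain p where "\<And>s. k2 (p * s) = m4 * k2 s"
        using scalings_surj[OF finK k2(3) scal] by blast
      then have "\<beta> a' s = p * s" for s
        using m4[of s] k2(3) by (metis injD)
      then show ?thesis by blast
    qed
    then show ?thesis
      using nonmult by (simp add: multiplicative_def)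
  qed
qed

text \<open>By \<open>\<mu>_line\<close> the map \<open>\<mu>\<close> falls under
  \<open>collineation_additive\<close>, and \<open>g\<close> transfers its additivity to
  \<open>\<beta>\<close>. Preservation of the line through \<open>a\<close> and \<open>b\<close>
  needs \<open>E a\<close> or \<open>E b\<close> to be Desarguesian, which \<open>bad_unique\<close>
  grants.\<close>

lemma \<beta>_additive:
  assumes "\<not> multiplicative"
  shows "\<beta> (a + b) s = \<beta> a s + \<beta> b s"
proof -
  obtain g \<mu> where g: "\<And>s t. g (s + t) = g s + g t" "\<And>c s. g (\<iota> c * s) = \<iota> c * g s" "inj g"
    and \<mu>: "inj \<mu>" "\<And>a s. g (\<beta> a s) = \<mu> a * g s"
    by (fact slopes_at_B)
  note line = \<mu>_line[OF g \<mu> _ _ assms]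
  interpret g: Modules.additive g
    using g(1) by unfold_locales
  have "\<mu> (a + b) = \<mu> a + \<mu> b"
  proof (rule collineation_additive[OF K.vector_space_axioms K.vector_space_axioms finF card_gt_2 \<mu>(1)])
    have "g 1 \<noteq> 0"
      using g(3) g.zero by (metis injD zero_neq_one)
    then show "\<mu> 0 = 0"
      using \<mu>(2)[of 0 1] by (simp add: \<beta>_0 g.zero)
  next
    fix a b c
    consider "a = b" | "a \<noteq> b" "good (E a)" | "a \<noteq> b" "good (E b)"
      using bad_unique[of "E a" "E b"] by fastforce
    then show "\<exists>c'. \<mu> (a + \<iota> c * (b - a)) = \<mu> a + \<iota> c' * (\<mu> b - \<mu> a)"
    proof cases
      case 3
      \<comment> \<open>The line is traversed from \<open>b\<close> to \<open>a\<close>, which turns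
        the parameters into \<open>1 - c\<close> and \<open>1 - c'\<close>.\<close>
      then obtain c' where "\<mu> (b + \<iota> (1 - c) * (a - b)) = \<mu> b + \<iota> c' * (\<mu> a - \<mu> b)"
        using line[of b a "1 - c"] by auto
      then have "\<mu> (a + \<iota> c * (b - a)) = \<mu> a + \<iota> (1 - c') * (\<mu> b - \<mu> a)"
        by (simp add: \<iota>_diff \<iota>_simps algebra_simps)
      then show ?thesis ..
    qed (use line in auto)
  next
    fix b
    \<comment> \<open>As \<open>n > 1\<close>, the multiples of \<open>b\<close> by the base field
      do not fill the big field.\<close>
    have "card (range (\<lambda>c. \<iota> c * b)) \<le> CARD('a)"
      by (rule card_image_le[OF finF])
    also have "\<dots> < CARD('a) ^ n"
      using card_gt_2 prime_gt_1_nat[OF prime_n] power_strict_increasing[of 1 n "CARD('a)"] by simp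
    finally have "range (\<lambda>c. \<iota> c * b) \<noteq> UNIV"
      using cardK by auto
    then show "\<exists>e. e \<notin> range (\<lambda>c. \<iota> c * b)"
      by blast
  qed
  then have "g (\<beta> (a + b) s) = g (\<beta> a s + \<beta> b s)"
    by (simp add: \<mu>(2) g.add distrib_right)
  then show ?thesis
    using g(3) by (simp add: inj_eq)
qed

section \<open>Exchange of coordinate spaces and characteristic two\<close>

text \<open>Interchanging \<open>x\<close> and \<open>y\<close> interchanges \<open>E 0\<close> and
  \<open>B\<close> and inverts the slope \<open>a\<close>. Results on \<open>\<beta>\<close> thereby
  apply to the maps \<open>\<beta> (inverse a) (a * s)\<close> as well.\<close>

lemma swap: "hyperoval_coordinates smul \<iota> n H y x z (\<lambda>a s. \<beta> (inverse a) (a * s))"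
proof (unfold_locales)
  show "\<exists>v. y v = p \<and> x v = q \<and> z v = r" for p q r
    using coords_surj by blast
  show "v = w" if "y v = y w" "x v = x w" "z v = z w" for v w
    using coords_inj that by blast
  define E' where "E' a = {v. x v = a * y v \<and> z v = \<beta> (inverse a) (a * y v)}" for a
  have E': "E' a = E (inverse a)" if "a \<noteq> 0" for a
    using that by (auto simp: E'_def E_def field_simps)
  \<comment> \<open>Since \<open>\<beta> 0\<close> vanishes and \<open>inverse 0 = 0\<close>, the
    new index 0 belongs to the old \<open>B\<close>.\<close>
  have E'_0: "E' 0 = B"
    by (auto simp: E'_def B_def \<beta>_0)
  have "range E' = insert B (E ` (UNIV - {0}))"
  proof
    show "range E' \<subseteq> insert B (E ` (UNIV - {0}))"
    proof (rule image_subsetI)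
      fix a
      show "E' a \<in> insert B (E ` (UNIV - {0}))"
        by (cases "a = 0") (simp_all add: E' E'_0)
    qed
    have "E a \<in> range E'" if "a \<noteq> 0" for a
      using E'[of "inverse a"] that by (intro range_eqI[of _ _ "inverse a"]) simp
    moreover have "B \<in> range E'"
      using E'_0 by blast
    ultimately show "insert B (E ` (UNIV - {0})) \<subseteq> range E'"
      by blast
  qed
  then have "{E 0, C} \<union> range E' = H"
    unfolding H_eq' by auto
  then show "H = {{v. y v = 0 \<and> z v = 0}, {v. y v = 0 \<and> x v = 0}} \<union>
    range (\<lambda>a. {v. x v = a * y v \<and> z v = \<beta> (inverse a) (a * y v)})"
    by (simp add: E'_def E_0 C_def conj_commute)
qed (use good_frame lin_xyz in \<open>simp_all add: \<beta>_0 \<beta>_1 conj_commute\<close>)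

text \<open>Otherwise \<open>\<beta>\<close> and \<open>\<phi>\<close> are both additive in the
  index, which forces them to agree. Then \<open>g\<close> carries multiplications to
  multiplications, and as it also conjugates \<open>\<beta> a\<close> to a multiplication,
  \<open>\<beta> a\<close> is one after all.\<close>

lemma multiplicative: multiplicative
proof (rule ccontr)
  assume nonmult: "\<not> multiplicative"
  interpret swap: hyperoval_coordinates smul \<iota> n H y x z "\<lambda>a s. \<beta> (inverse a) (a * s)"
    by (fact swap)
  define \<phi> where "\<phi> a s = \<beta> (inverse a) (a * s)" for a s
  have "\<not> swap.multiplicative"
  proof
    assume *: "swap.multiplicative"
    \<comment> \<open>The exchange is an involution: the swapped formula, taken at
      \<open>inverse a\<close> and \<open>a * s\<close>, returns \<open>\<beta> a s\<close>.\<close>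
    have "\<exists>p. \<forall>s. \<beta> a s = p * s" for a
    proof (cases "a = 0")
      case True
      then show ?thesis by (auto simp: \<beta>_0)
    next
      case False
      obtain p where "\<And>s. \<beta> (inverse (inverse a)) (inverse a * s) = p * s"
        using * unfolding swap.multiplicative_def by blast
      from this[of "a * s" for s] have "\<beta> a s = p * a * s" for s
        using False by (simp add: mult.assoc flip: mult.assoc[of "inverse a"])
      then show ?thesis by blast
    qed
    then show False
      using nonmult by (simp add: multiplicative_def)
  qed
  then have \<phi>_add: "\<phi> (a + b) s = \<phi> a s + \<phi> b s" for a b s
    unfolding \<phi>_def by (rule swap.\<beta>_additive)
  note \<beta>_add' = \<beta>_additive[OF nonmult]
  have \<phi>_inverse: "\<phi> (inverse a) s = \<beta> a (inverse a * s)" for a s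
    by (simp add: \<phi>_def)
  have \<phi>_01: "\<phi> 0 s = 0" "\<phi> 1 s = s" for s
    by (simp_all add: \<phi>_def \<beta>_0 \<beta>_1)
  have two: "u + u = 0" for u :: 'k
    using char2 by (metis distrib_right mult_1 mult_zero_left)
  text \<open>The two additive maps agree: \<open>1/(1+t) = 1 + 1/(1 + 1/t)\<close> in characteristic two.\<close>
  have \<beta>\<phi>: "\<beta> w u = \<phi> w u" for w u
  proof (cases "w = 0 \<or> w = 1")
    case True
    then show ?thesis by (auto simp: \<phi>_01 \<beta>_0 \<beta>_1)
  next
    case False
    define t where "t = 1 + w"
    define a where "a = inverse t"
    have "1 + w \<noteq> 0"
      using False two[of 1] by (metis add_left_cancel)
    then have t: "t \<noteq> 0" "a \<noteq> 0" "t = inverse a"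
      by (simp_all add: t_def a_def)
    have w: "w = 1 + t"
      using two[of 1] by (simp add: t_def flip: add.assoc)
    have "a * t = 1"
      using t(1) by (simp add: a_def)
    then have a1: "a + 1 = a * w"
      by (simp add: w distrib_left)
    then have "a + 1 \<noteq> 0"
      using False t(2) by simp
    have "inverse w = 1 + inverse (a + 1)"
    proof -
      have "(1 + inverse (a + 1)) * (a + 1) = a + (1 + 1)"
        using \<open>a + 1 \<noteq> 0\<close> by (simp add: distrib_right)
      also have "\<dots> = inverse w * (a * w)"
        using False two[of 1] by simp
      also have "\<dots> = inverse w * (a + 1)"
        by (simp only: a1)
      finally show ?thesis
        using \<open>a + 1 \<noteq> 0\<close> by simp
    qed
    have r: "inverse (a + 1) * (w * u) = inverse a * u"
      using False t(2) by (simp add: a1)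
    \<comment> \<open>Three additivities are used in turn: of \<open>\<phi>\<close> at
      \<open>inverse w\<close>, of \<open>\<beta>\<close> at \<open>a + 1\<close>, and of
      \<open>\<phi>\<close> at \<open>w = 1 + t\<close>. The two terms \<open>t * u\<close> cancel
      in characteristic two.\<close>
    have "\<beta> w u = \<phi> (inverse w) (w * u)"
      using False by (simp add: \<phi>_def flip: mult.assoc)
    also have "\<dots> = w * u + \<phi> (inverse (a + 1)) (w * u)"
      by (simp only: \<open>inverse w = _\<close> \<phi>_add \<phi>_01)
    also have "\<phi> (inverse (a + 1)) (w * u) = \<beta> a (inverse a * u) + inverse a * u"
      by (simp only: \<phi>_inverse r \<beta>_add' \<beta>_1)
    also have "\<beta> a (inverse a * u) = \<phi> t u"
      by (simp add: t(3) \<phi>_inverse)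
    also have "w * u + (\<phi> t u + inverse a * u) = \<phi> t u + u + (t * u + t * u)"
      by (simp add: w t(3) distrib_right algebra_simps)
    also have "\<dots> = \<phi> w u"
      by (simp add: two w \<phi>_add \<phi>_01 add.commute)
    finally show ?thesis .
  qed
  obtain g \<mu> where g: "\<And>s t. g (s + t) = g s + g t" "\<And>c s. g (\<iota> c * s) = \<iota> c * g s" "inj g"
    and \<mu>: "inj \<mu>" "\<And>a s. g (\<beta> a s) = \<mu> a * g s"
    by (fact slopes_at_B)
  interpret g: Modules.additive g
    using g(1) by unfold_locales
  have "\<mu> 0 * g 1 = 0"
    using \<mu>(2)[of 0 1] by (simp add: \<beta>_0 g.zero)
  then have "\<mu> 0 = 0"
    using g(3) g.zero by (metis injD mult_eq_0_iff zero_neq_one)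
  \<comment> \<open>Since \<open>\<beta> p s = \<beta> (inverse p) (p * s)\<close>, applying
    \<open>g\<close> gives \<open>\<mu> p * g s = \<mu> (inverse p) * g (p * s)\<close>.\<close>
  have scal: "\<exists>m. \<forall>s. g (p * s) = m * g s" for p
  proof (cases "p = 0")
    case False
    then have "\<mu> (inverse p) \<noteq> 0"
      using \<open>\<mu> 0 = 0\<close> \<mu>(1) by (metis injD inverse_zero_imp_zero)
    moreover have "g (p * s) * \<mu> (inverse p) = \<mu> p * g s" for s
      using \<beta>\<phi>[of p s] by (simp add: \<phi>_def mult.commute[of "g (p * s)"] flip: \<mu>(2))
    ultimately have "g (p * s) = \<mu> p / \<mu> (inverse p) * g s" for s
      by (simp add: nonzero_eq_divide_eq)
    then show ?thesis by blast
  qed (auto simp: g.zero)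
  have "\<exists>p. \<forall>s. \<beta> a s = p * s" for a
  proof -
    obtain p where "\<And>s. g (p * s) = \<mu> a * g s"
      using scalings_surj[OF finK g(3) scal] by blast
    then have "\<beta> a s = p * s" for s
      using \<mu>(2)[of a s] g(3) by (metis injD)
    then show ?thesis by blast
  qed
  then show False
    using nonmult by (simp add: multiplicative_def)
qed

end

subsection \<open>Existence of coordinates\<close>

context desarguesian_pseudo_hyperoval
begin

text \<open>An injective linear map from \<open>X\<close> to the big field is onto, as both have the
  same number of elements.\<close>

lemma surj_on_H:
  assumes X: "X \<in> H" and "lin \<rho>" and "\<And>v. v \<in> X \<Longrightarrow> \<rho> v = 0 \<Longrightarrow> v = 0"
  shows "\<exists>v\<in>X. \<rho> v = p"
proof -
  interpret \<rho>: module_hom smul kscale \<rho> by fact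
  have "inj_on \<rho> X"
    using \<rho>.inj_on_iff_eq_0[OF subspace_H[OF X]] assms(3) by blast
  then have "card (\<rho> ` X) = CARD('k)"
    using card_image card_H[OF X] by metis
  then have "\<rho> ` X = UNIV"
    by (intro card_subset_eq[OF finK]) simp_all
  then show ?thesis
    by (metis imageE UNIV_I)
qed

text \<open>Seen from \<open>C\<close>, slopes normalised by \<open>B\<close>, \<open>A\<close>,
  \<open>D\<close> give \<open>x\<close> and \<open>y\<close>; seen from \<open>B\<close>, slopes
  normalised by \<open>C\<close>, \<open>A\<close>, \<open>D\<close> give \<open>r\<close> and
  \<open>t\<close>. Both \<open>x\<close> and \<open>r\<close> vanish on \<open>B\<close> and
  \<open>C\<close>, so \<open>r\<close> is a bijective function \<open>g\<close> of
  \<open>x\<close>, and applying the inverse of \<open>g\<close> to \<open>t\<close> yields a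
  coordinate \<open>z\<close> on the scale of \<open>x\<close>.\<close>

lemma coordinates_exist:
  assumes H: "A \<in> H" "B \<in> H" "C \<in> H" and good: "good A" "good B" "good C"
    and ne: "A \<noteq> B" "A \<noteq> C" "B \<noteq> C"
  shows "\<exists>x y z \<beta>. hyperoval_coordinates smul \<iota> n H x y z \<beta>"
proof -
  have "\<not> H \<subseteq> {A, B, C}"
    using cardH card_mono[of "{A, B, C}" H] by (auto simp: card_insert_if split: if_splits)
  then obtain D where D: "D \<in> H" "D \<noteq> A" "D \<noteq> B" "D \<noteq> C"
    by blast
  have HC: "C \<in> H" "B \<in> H" "A \<in> H" "D \<in> H" "good C" "B \<noteq> C" "A \<noteq> C" "D \<noteq> C" "B \<noteq> A" "B \<noteq> D" "A \<noteq> D"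
    using H good ne D by auto
  have HB: "B \<in> H" "C \<in> H" "A \<in> H" "D \<in> H" "good B" "C \<noteq> B" "A \<noteq> B" "D \<noteq> B" "C \<noteq> A" "C \<noteq> D" "A \<noteq> D"
    using H good ne D by auto
  obtain x y where lin_xy: "lin x" "lin y" and kerC: "\<And>v. v \<in> C \<longleftrightarrow> x v = 0 \<and> y v = 0"
    and xy: "\<And>v. v \<in> B \<Longrightarrow> x v = 0" "\<And>v. v \<in> A \<Longrightarrow> y v = 0" "\<And>v. v \<in> D \<Longrightarrow> x v = y v"
    and slope: "\<And>G. G \<in> H \<Longrightarrow> G \<noteq> C \<Longrightarrow> G \<noteq> B \<Longrightarrow> \<exists>m. span (C \<union> G) = {v. y v = m * x v}"
    and slope_surj: "\<And>m. \<exists>G\<in>H. G \<noteq> C \<and> G \<noteq> B \<and> span (C \<union> G) = {v. y v = m * x v}"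
    by (fact good_slopes[OF HC])
  obtain r t where lin_rt: "lin r" "lin t" and kerB: "\<And>v. v \<in> B \<longleftrightarrow> r v = 0 \<and> t v = 0"
    and rt: "\<And>v. v \<in> C \<Longrightarrow> r v = 0" "\<And>v. v \<in> A \<Longrightarrow> t v = 0" "\<And>v. v \<in> D \<Longrightarrow> r v = t v"
    and slope': "\<And>G. G \<in> H \<Longrightarrow> G \<noteq> B \<Longrightarrow> G \<noteq> C \<Longrightarrow> \<exists>m. span (B \<union> G) = {v. t v = m * r v}"
    and "\<And>m. \<exists>G\<in>H. G \<noteq> B \<and> G \<noteq> C \<and> span (B \<union> G) = {v. t v = m * r v}"
    by (fact good_slopes[OF HB])
  interpret x: module_hom smul kscale x by fact
  interpret y: module_hom smul kscale y by fact
  interpret r: module_hom smul kscale r by fact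
  interpret t: module_hom smul kscale t by fact
  have sub: "F \<subseteq> span (E \<union> F)" for E F
    by (auto intro: span_base)
  have x_on: "\<exists>v\<in>G. x v = p" if G: "G \<in> H" "G \<noteq> B" "G \<noteq> C" for G p
  proof (rule surj_on_H[OF G(1) lin_xy(1)])
    fix v assume v: "v \<in> G" "x v = 0"
    obtain m where "span (C \<union> G) = {v. y v = m * x v}"
      using slope G by blast
    then have "y v = m * x v"
      using v(1) sub by blast
    then show "v = 0"
      using disjoint_H[OF G(1) H(3) G(3) v(1)] v(2) by (simp add: kerC)
  qed
  have y_on: "\<exists>v\<in>B. y v = p" for p
    using disjoint_H[OF H(2,3) ne(3)] xy(1) by (intro surj_on_H[OF H(2) lin_xy(2)]) (simp add: kerC)
  have t_on: "\<exists>v\<in>C. t v = p" for p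
    using disjoint_H[OF H(2,3) ne(3)] rt(1) by (intro surj_on_H[OF H(3) lin_rt(2)]) (simp add: kerB)
  \<comment> \<open>A section of \<open>x\<close> inside \<open>A\<close>, where \<open>y\<close>
    and \<open>t\<close> vanish.\<close>
  obtain sA where sA: "\<And>p. sA p \<in> A" "\<And>p. x (sA p) = p"
    using x_on[OF H(1) ne(1,2)] by metis
  define g where "g p = r (sA p)" for p
  have rg: "r v = g (x v)" for v
  proof -
    \<comment> \<open>Subtracting \<open>b\<close> corrects the \<open>y\<close>-coordinate without
      changing \<open>x\<close> or \<open>r\<close>, so the difference below falls into
      \<open>C\<close>.\<close>
    obtain b where b: "b \<in> B" "y b = y v"
      using y_on by blast
    have "v - sA (x v) - b \<in> C"
      using b sA xy by (simp add: kerC x.diff y.diff)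
    then have "r (v - sA (x v) - b) = 0"
      by (rule rt)
    then show ?thesis
      using b(1) by (simp add: r.diff g_def kerB)
  qed
  have g_add: "g (p + p') = g p + g p'" for p p'
    using rg[of "sA p + sA p'"] by (simp add: r.add x.add sA g_def)
  have g_scale: "g (\<iota> c * p) = \<iota> c * g p" for c p
    using rg[of "c \<odot> sA p"] by (simp add: r.scale x.scale sA g_def)
  interpret g: Modules.additive g
    using g_add by unfold_locales
  have "inj g"
  proof (rule injI)
    fix p p' assume eq: "g p = g p'"
    have *: "sA p - sA p' \<in> A"
      using sA subspace_diff[OF subspace_H[OF H(1)]] by blast
    moreover have "sA p - sA p' \<in> B"
      using eq rt(2)[OF *] by (simp add: kerB r.diff g_def)
    ultimately have "sA p - sA p' = 0"
      using disjoint_H H ne by blast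
    then show "p = p'"
      using sA(2) by (metis eq_iff_diff_eq_0)
  qed
  then have "surj g"
    using finK finite_UNIV_inj_surj by blast
  define h where "h = inv g"
  have gh: "g (h s) = s" and hg: "h (g s) = s" for s
    using \<open>surj g\<close> \<open>inj g\<close> by (simp_all add: h_def surj_f_inv_f)
  have h_eqI: "h u = s" if "g s = u" for s u
    using that hg by blast
  define z where "z v = h (t v)" for v
  have lin_z: "lin z"
  proof (rule linI)
    show "z (v + w) = z v + z w" for v w
      unfolding z_def by (rule h_eqI) (simp add: g_add gh t.add)
    show "z (c \<odot> v) = \<iota> c * z v" for c v
      unfolding z_def by (rule h_eqI) (simp add: g_scale gh t.scale)
  qed
  have coords_inj: "v = w" if "x v = x w" "y v = y w" "z v = z w" for v w
  proof -
    have "t v = t w"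
      using that(3) gh unfolding z_def by metis
    then have "v - w \<in> B" "v - w \<in> C"
      using that by (simp_all add: kerB kerC rg x.diff y.diff t.diff g.zero)
    then show ?thesis
      using disjoint_H[OF H(2,3) ne(3)] by (metis eq_iff_diff_eq_0)
  qed
  have coords_surj: "\<exists>v. x v = p \<and> y v = q \<and> z v = s" for p q s
  proof -
    obtain b c where b: "b \<in> B" "y b = q" and c: "c \<in> C" "t c = g s"
      using y_on t_on by metis
    have "x (sA p + b + c) = p" "y (sA p + b + c) = q"
      using b c sA xy(1,2) by (simp_all add: x.add y.add kerC)
    moreover have "z (sA p + b + c) = s"
      using b(1) c sA(1)[of p] rt(2) by (simp add: z_def t.add kerB hg)
    ultimately show ?thesis by blast
  qed
  \<comment> \<open>\<open>G a\<close> is the element whose slope seen from \<open>C\<close> is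
    \<open>a\<close>; its slope \<open>m a\<close> seen from \<open>B\<close>, conjugated by
    \<open>g\<close>, is \<open>\<beta> a\<close>.\<close>
  obtain G where G: "\<And>a. G a \<in> H" "\<And>a. G a \<noteq> C" "\<And>a. G a \<noteq> B"
    and spC: "\<And>a. span (C \<union> G a) = {v. y v = a * x v}"
    using slope_surj by metis
  have "\<exists>m. span (B \<union> G a) = {v. t v = m * r v}" for a
    by (rule slope'[OF G(1) G(3) G(2)])
  then obtain m where spB: "\<And>a. span (B \<union> G a) = {v. t v = m a * r v}"
    by metis
  define \<beta> where "\<beta> a s = h (m a * g s)" for a s
  have mem_G: "y v = a * x v" "z v = \<beta> a (x v)" if "v \<in> G a" for a v
    using that sub[of "G a" C] sub[of "G a" B] unfolding spC spB by (auto simp: z_def \<beta>_def rg)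
  have G_eq: "G a = {v. y v = a * x v \<and> z v = \<beta> a (x v)}" for a
  proof
    show "G a \<subseteq> {v. y v = a * x v \<and> z v = \<beta> a (x v)}"
      using mem_G by blast
    show "{v. y v = a * x v \<and> z v = \<beta> a (x v)} \<subseteq> G a"
    proof clarify
      fix v assume v: "y v = a * x v" "z v = \<beta> a (x v)"
      obtain w where w: "w \<in> G a" "x w = x v"
        using x_on[OF G(1) G(3) G(2)] by blast
      then have "v = w"
        using v mem_G[OF w(1)] by (intro coords_inj) simp_all
      then show "v \<in> G a"
        using w by simp
    qed
  qed
  \<comment> \<open>Elements of equal slope seen from \<open>C\<close> coincide by the arc
    condition, so \<open>G\<close> reaches all elements but \<open>B\<close> and
    \<open>C\<close>.\<close>
  have G_cover: "F \<in> range G" if F: "F \<in> H" "F \<noteq> B" "F \<noteq> C" for F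
  proof -
    obtain a where "span (C \<union> F) = {v. y v = a * x v}"
      using slope F by blast
    then have "F \<subseteq> span (C \<union> G a)"
      using sub spC by blast
    then have "F = G a"
      using not_subset_span[OF H(3) G(1) F(1)] G(2) F by blast
    then show ?thesis by blast
  qed
  have A: "A = G 0"
  proof -
    obtain a where a: "A = G a"
      using G_cover[OF H(1) ne(1,2)] by blast
    then show ?thesis
      using mem_G(1)[of "sA 1" a] sA xy(2) by simp
  qed
  have Dv: "\<exists>v\<in>D. x v = s" for s
    by (rule x_on[OF D(1,3,4)])
  have DG: "D = G 1"
  proof -
    obtain a where a: "D = G a"
      using G_cover[OF D(1,3,4)] by blast
    obtain v where v: "v \<in> D" "x v = 1"
      using Dv by blast
    have "y v = a"
      using mem_G(1)[of v a] v a by simp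
    moreover have "y v = 1"
      using xy(3)[OF v(1)] v(2) by simp
    ultimately show ?thesis
      using a by simp
  qed
  have \<beta>_0: "\<beta> 0 s = 0" for s
    using mem_G(2)[of "sA s" 0] sA rt(2)[of "sA s"] hg[of 0] by (simp add: A z_def g.zero)
  have \<beta>_1: "\<beta> 1 s = s" for s
  proof -
    obtain v where v: "v \<in> D" "x v = s"
      using Dv by blast
    have "z v = h (r v)"
      using rt(3)[OF v(1)] by (simp add: z_def)
    then have "z v = s"
      by (simp add: rg hg v(2))
    then show ?thesis
      using mem_G(2)[of v 1] v by (simp add: DG)
  qed
  have Beq: "B = {v. x v = 0 \<and> z v = 0}"
  proof -
    have "r v = 0 \<longleftrightarrow> x v = 0" for v
      using \<open>inj g\<close> unfolding rg by (metis g.zero injD)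
    moreover have "t v = 0 \<longleftrightarrow> z v = 0" for v
      unfolding z_def by (metis gh hg g.zero)
    ultimately show ?thesis
      using kerB by blast
  qed
  have Ceq: "C = {v. x v = 0 \<and> y v = 0}"
    using kerC by blast
  have Aeq: "A = {v. y v = 0 \<and> z v = 0}"
    by (simp add: A G_eq \<beta>_0)
  have "H = {B, C} \<union> range G"
    using G_cover G(1) H by blast
  then have "H = {{v. x v = 0 \<and> z v = 0}, {v. x v = 0 \<and> y v = 0}} \<union>
      range (\<lambda>a. {v. y v = a * x v \<and> z v = \<beta> a (x v)})"
    unfolding Beq Ceq G_eq .
  then have "hyperoval_coordinates_axioms smul \<iota> H x y z \<beta>"
    using lin_xy lin_z coords_surj coords_inj \<beta>_0 \<beta>_1 good[unfolded Aeq Beq Ceq]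
    by (intro hyperoval_coordinates_axioms.intro)
  then have "hyperoval_coordinates smul \<iota> n H x y z \<beta>"
    by (intro hyperoval_coordinates.intro desarguesian_pseudo_hyperoval_axioms)
  then show ?thesis by blast
qed

end

section \<open>Field reduction from the coordinates\<close>

text \<open>With multiplications for all \<open>\<beta> a\<close>, every element of \<open>H\<close>
  is one-dimensional over the big field in the coordinates, hence a point of the plane; the arc
  property descends from \<open>H\<close>.\<close>

lemma (in hyperoval_coordinates) elementary: "elementary smul \<iota> H"
proof -
  obtain p where p: "\<And>a s. \<beta> a s = p a * s"
    using multiplicative unfolding multiplicative_def by metis
  define \<phi> :: "'k ^ 3 \<Rightarrow> 'v" where "\<phi> w = vec (w $ 1) (w $ 2) (w $ 3)" for w
  have bij: "bij \<phi>"
  proof (rule bijI)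
    show "inj \<phi>"
    proof (rule injI)
      fix v w assume "\<phi> v = \<phi> w"
      then have "x (\<phi> v) = x (\<phi> w)" "y (\<phi> v) = y (\<phi> w)" "z (\<phi> v) = z (\<phi> w)"
        by simp_all
      then show "v = w"
        by (simp add: \<phi>_def vec_eq_iff forall_3)
    qed
    have "v = \<phi> (vector [x v, y v, z v])" for v
      by (simp add: \<phi>_def) (rule vec_eqI; simp)
    then show "surj \<phi>"
      by blast
  qed
  have \<phi>_add: "\<phi> (v + w) = \<phi> v + \<phi> w" for v w
    by (simp add: \<phi>_def vec_add)
  have "\<phi> (\<iota> c *s v) = c \<odot> \<phi> v" for c v
    by (simp add: \<phi>_def vec_scale)
  then have iso: "field_reduction_iso \<iota> UNIV (+) smul \<phi>"
    using bij \<phi>_add by (simp add: field_reduction_iso_def)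
  have \<phi>_0: "\<phi> 0 = 0"
    using \<phi>_add[of 0 0] by simp
  have ray: "\<phi> -` {v. y v = a * x v \<and> z v = b * x v} = range (\<lambda>c. c *s vector [1, a, b])" for a b
  proof -
    have "w \<in> range (\<lambda>c. c *s vector [1, a, b])" if "w $ 2 = a * w $ 1" "w $ 3 = b * w $ 1" for w :: "'k ^ 3"
      using that by (intro range_eqI[of _ _ "w $ 1"]) (simp add: vec_eq_iff forall_3)
    then show ?thesis
      by (auto simp: \<phi>_def)
  qed
  have pt: "\<phi> -` F \<in> pg_points" if F: "F \<in> H" for F
  proof -
    consider "F = B" | "F = C" | a where "F = E a"
      using F H_eq' by blast
    then have "\<exists>q. q \<noteq> 0 \<and> \<phi> -` F = range (\<lambda>c. c *s q)"
    proof cases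
      case 1
      have "w \<in> range (\<lambda>c. c *s vector [0, 1, 0])" if "w $ 1 = 0" "w $ 3 = 0" for w :: "'k ^ 3"
        using that by (intro range_eqI[of _ _ "w $ 2"]) (simp add: vec_eq_iff forall_3)
      then have "\<phi> -` F = range (\<lambda>c. c *s vector [0, 1, 0])"
        by (auto simp: \<phi>_def 1 mem_BCE)
      then show ?thesis
        by (intro exI[of _ "vector [0, 1, 0]"]) (simp add: vec_eq_iff forall_3)
    next
      case 2
      have "w \<in> range (\<lambda>c. c *s vector [0, 0, 1])" if "w $ 1 = 0" "w $ 2 = 0" for w :: "'k ^ 3"
        using that by (intro range_eqI[of _ _ "w $ 3"]) (simp add: vec_eq_iff forall_3)
      then have "\<phi> -` F = range (\<lambda>c. c *s vector [0, 0, 1])"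
        by (auto simp: \<phi>_def 2 mem_BCE)
      then show ?thesis
        by (intro exI[of _ "vector [0, 0, 1]"]) (simp add: vec_eq_iff forall_3)
    next
      case 3
      then show ?thesis
        using ray[of a "p a"] by (intro exI[of _ "vector [1, a, p a]"]) (simp add: E_def p vec_eq_iff forall_3)
    qed
    then show ?thesis
      by (simp add: pg_points_span)
  qed
  \<comment> \<open>Although \<open>\<phi>\<close> is linear over the base field only, the multiples
    \<open>a *s u\<close> and \<open>b *s v\<close> stay in \<open>P\<close> and \<open>Q\<close>. A
    dependence over the big field thus puts a nonzero vector of \<open>F3\<close> into
    \<open>span (F1 \<union> F2)\<close>.\<close>
  have arc': "\<not> (P \<subseteq> L \<and> Q \<subseteq> L \<and> R \<subseteq> L)"
    if F: "F1 \<in> H" "F2 \<in> H" "F3 \<in> H" and PQR: "P = \<phi> -` F1" "Q = \<phi> -` F2" "R = \<phi> -` F3"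
      and ne: "P \<noteq> Q" "P \<noteq> R" "Q \<noteq> R" and L: "L \<in> pg_lines" for F1 F2 F3 P Q R L
  proof
    assume sub: "P \<subseteq> L \<and> Q \<subseteq> L \<and> R \<subseteq> L"
    obtain u where u: "u \<noteq> 0" "P = range (\<lambda>c. c *s u)"
      using pt[OF F(1)] PQR by (auto simp: pg_points_span)
    obtain v where v: "v \<noteq> 0" "Q = range (\<lambda>c. c *s v)"
      using pt[OF F(2)] PQR by (auto simp: pg_points_span)
    obtain w where w: "w \<noteq> 0" "R = range (\<lambda>c. c *s w)"
      using pt[OF F(3)] PQR by (auto simp: pg_points_span)
    have mem: "c *s u \<in> P" "c *s v \<in> Q" "c *s w \<in> R" for c
      using u v w by blast+
    have neF: "F1 \<noteq> F2" "F1 \<noteq> F3" "F2 \<noteq> F3"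
      using ne PQR by auto
    have nz: "\<phi> s \<noteq> 0" if "s \<noteq> 0" for s
      using that \<phi>_0 bij by (metis bij_is_inj injD)
    have "u \<notin> vec.span {v}"
    proof
      assume "u \<in> vec.span {v}"
      then have "u \<in> Q"
        by (auto simp: vec.span_singleton v(2))
      then have "\<phi> u = 0"
        using disjoint_H[OF F(1,2) neF(1)] mem(1)[of 1] by (simp add: PQR)
      then show False
        using nz u by blast
    qed
    then have indep: "vec.independent {u, v}" and "u \<noteq> v"
      using v(1) by (auto simp: vec.independent_insert intro: vec.span_base)
    have "{u, v} \<subseteq> L" "card {u, v} = vec.dim L"
      using sub mem(1,2)[of 1] L \<open>u \<noteq> v\<close> by (auto simp: pg_lines_def)
    then have "L \<subseteq> vec.span {u, v}"
      using vec.card_eq_dim[of "{u, v}" L] indep by simp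
    then have "w \<in> vec.span {u, v}"
      using sub mem(3)[of 1] by auto
    then obtain a b where "w - a *s u = b *s v"
      by (auto simp: vec.span_insert vec.span_singleton)
    then have "w = a *s u + b *s v"
      by (simp add: algebra_simps)
    then have "\<phi> w = \<phi> (a *s u) + \<phi> (b *s v)"
      by (simp add: \<phi>_add)
    moreover have "\<phi> (a *s u) \<in> F1" "\<phi> (b *s v) \<in> F2"
      using mem by (auto simp: PQR)
    ultimately have "\<phi> w \<in> span (F1 \<union> F2)"
      by (simp add: span_add span_base)
    moreover have "\<phi> w \<in> F3"
      using mem(3)[of 1] by (simp add: PQR)
    ultimately have "\<phi> w = 0"
      using pseudo_arcD[OF F neF] by blast
    then show False
      using nz w by blast
  qed
  define \<A> where "\<A> = (\<lambda>F. \<phi> -` F) ` H"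
  have "pg_arc \<A>"
    unfolding pg_arc_def
  proof (intro conjI ballI impI notI)
    show "\<A> \<subseteq> pg_points"
      using pt by (auto simp: \<A>_def)
    fix P Q R
    assume "P \<in> \<A>" "Q \<in> \<A>" "R \<in> \<A>" and ne: "P \<noteq> Q" "P \<noteq> R" "Q \<noteq> R"
      and L: "\<exists>L\<in>pg_lines. P \<subseteq> L \<and> Q \<subseteq> L \<and> R \<subseteq> L"
    then obtain F1 F2 F3 where "F1 \<in> H" "F2 \<in> H" "F3 \<in> H" "P = \<phi> -` F1" "Q = \<phi> -` F2" "R = \<phi> -` F3"
      by (auto simp: \<A>_def)
    from arc'[OF this ne] L show False
      by blast
  qed
  moreover have "H = field_reduction \<phi> \<A>"
    using bij by (simp add: field_reduction_def \<A>_def image_image surj_image_vimage_eq bij_is_surj)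
  ultimately show ?thesis
    unfolding elementary_def using iso by blast
qed

theorem corollary1p3:
  fixes smul :: "'a::field \<Rightarrow> 'v::ab_group_add \<Rightarrow> 'v"
    and \<iota> :: "'a \<Rightarrow> 'k::field"
    and q h n :: nat
    and H :: "'v set set"
  assumes "q = 2 ^ h" and "h > 1" and "prime n"
    and "CARD('a) = q"
    and "CARD('k) = q ^ n" and "field_embedding \<iota>"
    and "vector_space smul" and "vector_space.dim smul (UNIV :: 'v set) = 3 * n"
    and "pseudo_hyperoval smul n H"
    and "card {E \<in> H. induces_desarguesian smul \<iota> H E} \<ge> q ^ n + 1"
  shows "elementary smul \<iota> H"
proof -
  have q: "q \<ge> 4"
    using assms(1,2) power_increasing[of 2 h "2::nat"] by simp
  have n: "n > 0"
    using assms(3) by (rule prime_gt_0_nat)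
  then have qn: "q ^ n \<ge> 4"
    using q self_le_power[of q n] by simp
  have finK: "finite (UNIV :: 'k set)"
    using assms(5) q by (intro card_ge_0_finite) simp
  define X where "X = {E \<in> H. induces_desarguesian smul \<iota> H E}"
  have cardH: "card H = q ^ n + 2"
    using assms(4,9) by (simp add: pseudo_hyperoval_def)
  have finH: "finite H"
    using cardH by (intro card_ge_0_finite) simp
  have "X \<subseteq> H"
    by (auto simp: X_def)
  \<comment> \<open>Of the \<open>q ^ n + 2\<close> elements at most one lies outside
    \<open>X\<close>; this is what \<open>bad_unique\<close> demands.\<close>
  then have "card (H - X) \<le> 1"
    using cardH assms(10) finH by (simp add: card_Diff_subset finite_subset flip: X_def)
  then have bad: "E = F" if "E \<in> H - X" "F \<in> H - X" for E F
    using that finH by (metis card_le_Suc0_iff_eq One_nat_def finite_Diff)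
  interpret vector_space smul by fact
  interpret desarguesian_pseudo_hyperoval smul \<iota> n H
  proof
    show "(1 :: 'k) + 1 = 0"
      using finK assms(1,2,5) n q by (intro two_eq_0_if_even_card) simp_all
  qed (use assms(3-6,9) finK q qn cardH bad in \<open>auto simp: pseudo_hyperoval_def X_def\<close>)
  \<comment> \<open>Three Desarguesian elements are needed as coordinate spaces.\<close>
  have "3 \<le> card X"
    using assms(10) qn by (simp add: X_def)
  then obtain Y where "Y \<subseteq> X" "card Y = 3"
    using obtain_subset_with_card_n by metis
  then obtain A B C where "A \<in> X" "B \<in> X" "C \<in> X" "A \<noteq> B" "A \<noteq> C" "B \<noteq> C"
    by (auto simp: card_3_iff)
  then obtain x y z \<beta> where "hyperoval_coordinates smul \<iota> n H x y z \<beta>"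
    using coordinates_exist[of A B C] by (auto simp: X_def)
  then show ?thesis
    by (rule hyperoval_coordinates.elementary)
qed

end
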